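(* Let $(X,\varrho)$ be a countable graph metric space and let $p\geq 1$ be a fixed real number. Then the $p$-Wasserstein space $\mathcal{W}_p(X)$ is isometrically rigid: for every isometry $\Phi:\mathcal{W}_p(X)\to\mathcal{W}_p(X)$ (with respect to $d_p$) there exists an isometry $\psi:X\to X$ (with respect to $\varrho$) such that $\Phi=\psi_\#$; that is, the push-forward homomorphism $\psi\mapsto\psi_\#$ from $\mathrm{Isom}(X,\varrho)$ to $\mathrm{Isom}(\mathcal{W}_p(X),d_p)$ is onto, and $\mathrm{Isom}(\mathcal{W}_p(X),d_p)\cong\mathrm{Isom}(X,\varrho)$.
   Context: Graph metric space: a countable (finite or countably infinite) metric space $(X,\varrho)$ is a graph metric space if there is a connected (without loss of generality simple) graph $G(X,E)$ with vertex set $X$ such that $\varrho(x,y)$ equals the minimum number of edges in a path in $G(X,E)$ between $x$ and $y$, for all $x,y\in X$. Wasserstein space: every Borel measure $\mu$ on such $X$ is determined by its values $\mu(x):=\mu(\{x\})$ on singletons. For real $p\ge 1$, $\mathcal{W}_p(X)$ is the set of all probability measures $\mu$ on $X$ with $\sum_{x\in X}\varrho^p(x,\hat x)\mu(x)<\infty$ for some (hence all) $\hat x\in X$. $\Pi(\mu,\nu)$ is the set of couplings, i.e. probability measures $\pi$ on $X\times X$ with marginals $\mu$ and $\nu$. The metric is $d_p(\mu,\nu):=\big(\inf_{\pi\in\Pi(\mu,\nu)}\sum_{(x,x')\in X\times X}\varrho^p(x,x')\,\pi(x,x')\big)^{1/p}$. An isometry of a metric space is a distance preserving bijection of the space onto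 itself; $\mathrm{Isom}(Y,d)$ denotes the group (under composition) of isometries of $(Y,d)$; $\cong$ denotes isomorphism of groups. For $\psi\in\mathrm{Isom}(X,\varrho)$ the push-forward is $\big(\psi_\#(\mu)\big)(x):=\mu\big(\psi^{-1}(x)\big)$ for $\mu\in\mathcal{W}_p(X)$, $x\in X$. *)

theory Defs
  imports "HOL-Probability.Probability" "HOL-Algebra.Bij" "Graph_Theory.Digraph_Component"
begin

text \<open>
  The locale \<^locale>\<open>pair_bidirected_digraph\<close> (symmetric and loop-free arc set of ordered pairs,
  no finiteness assumption) models simple undirected graphs: an edge is the pair of its two
  orientations, and the length of a path, given as a list of arcs, is its number of edges.
\<close>

definition graph_metric_space :: "'a set \<Rightarrow> ('a \<Rightarrow> 'a \<Rightarrow> real) \<Rightarrow> bool" where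
  "graph_metric_space X \<rho> \<longleftrightarrow>
     Metric_space X \<rho> \<and>
     (\<exists>G. pair_bidirected_digraph G \<and> pverts G = X \<and> Digraph_Component.connected (with_proj G) \<and>
        (\<forall>x\<in>X. \<forall>y\<in>X.
           \<rho> x y = real (LEAST n. \<exists>P. pre_digraph.apath (with_proj G) x P y \<and> length P = n)))"

text \<open>
  A Borel probability measure on a countable discrete space \<open>X\<close> is a \<open>pmf\<close> whose support lies
  in \<open>X\<close>.
\<close>

definition wasserstein_space :: "'a set \<Rightarrow> ('a \<Rightarrow> 'a \<Rightarrow> real) \<Rightarrow> real \<Rightarrow> 'a pmf set" where
  "wasserstein_space X \<rho> p =
     {\<mu>. set_pmf \<mu> \<subseteq> X \<and> (\<exists>x0\<in>X. (\<lambda>x. \<rho> x x0 powr p * pmf \<mu> x) summable_on X)}"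

text \<open>If both marginals are supported in \<open>X\<close>, then the coupling is supported in \<open>X \<times> X\<close>.\<close>

definition couplings :: "'a pmf \<Rightarrow> 'b pmf \<Rightarrow> ('a \<times> 'b) pmf set" where
  "couplings \<mu> \<nu> = {\<pi>. map_pmf fst \<pi> = \<mu> \<and> map_pmf snd \<pi> = \<nu>}"

text \<open>
  For \<open>\<mu>\<close> and \<open>\<nu>\<close> in the Wasserstein space the cost of every coupling is summable (by
  \<open>\<rho>(x,x')\<^sup>p \<le> 2\<^sup>p (\<rho>(x,x0)\<^sup>p + \<rho>(x',x0)\<^sup>p)\<close>), so the value \<open>0\<close> of a divergent \<open>infsum\<close>
  never enters. The distance is only meant to be used on that space.
\<close>

definition wasserstein_dist ::
  "'a set \<Rightarrow> ('a \<Rightarrow> 'a \<Rightarrow> real) \<Rightarrow> real \<Rightarrow> 'a pmf \<Rightarrow> 'a pmf \<Rightarrow> real" where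
  "wasserstein_dist X \<rho> p \<mu> \<nu> =
     (INF \<pi>\<in>couplings \<mu> \<nu>.
        \<Sum>\<^sub>\<infinity>(x, x')\<in>X \<times> X. \<rho> x x' powr p * pmf \<pi> (x, x')) powr (1 / p)"

text \<open>
  As in \<^const>\<open>BijGroup\<close>, maps are extensional (\<^const>\<open>undefined\<close> outside \<open>Y\<close>), so that
  equality of group elements is equality of maps on \<open>Y\<close>.
\<close>

definition Isom :: "'b set \<Rightarrow> ('b \<Rightarrow> 'b \<Rightarrow> real) \<Rightarrow> ('b \<Rightarrow> 'b) monoid" where
  "Isom Y d = (BijGroup Y)
     \<lparr>carrier := {f \<in> Bij Y. \<forall>x\<in>Y. \<forall>y\<in>Y. d (f x) (f y) = d x y}\<rparr>"

lemma group_Isom: "group (Isom Y d)"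
proof -
  let ?H = "{f \<in> Bij Y. \<forall>x\<in>Y. \<forall>y\<in>Y. d (f x) (f y) = d x y}"
  have grp: "group (BijGroup Y)" by (rule group_BijGroup)
  have "subgroup ?H (BijGroup Y)"
  proof (rule group.subgroupI[OF grp])
    show "?H \<subseteq> carrier (BijGroup Y)" by (auto simp: BijGroup_def)
    show "?H \<noteq> {}" using id_Bij[of Y] by (auto intro!: exI[of _ "\<lambda>x\<in>Y. x"])
  next
    fix f assume f: "f \<in> ?H"
    then have "f ` Y = Y" by (auto simp: Bij_def bij_betw_def)
    then have inY: "inv_into Y f x \<in> Y" and inv: "f (inv_into Y f x) = x" if "x \<in> Y" for x
      using that by (auto intro: inv_into_into f_inv_into_f)
    have "d (inv_into Y f x) (inv_into Y f y) = d x y" if "x \<in> Y" "y \<in> Y" for x y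
      using f inY[OF that(1)] inY[OF that(2)] inv[OF that(1)] inv[OF that(2)]
      by (metis (mono_tags, lifting) mem_Collect_eq)
    then show "inv\<^bsub>BijGroup Y\<^esub> f \<in> ?H"
      using f by (auto simp: inv_BijGroup restrict_inv_into_Bij)
  next
    fix f g assume "f \<in> ?H" "g \<in> ?H"
    then show "f \<otimes>\<^bsub>BijGroup Y\<^esub> g \<in> ?H"
      by (auto simp: BijGroup_def compose_Bij compose_eq Pi_iff dest!: Bij_imp_funcset)
  qed
  then show ?thesis unfolding Isom_def by (rule subgroup.subgroup_is_group[OF _ grp])
qed

definition push_forward ::
  "'a set \<Rightarrow> ('a \<Rightarrow> 'a \<Rightarrow> real) \<Rightarrow> real \<Rightarrow> ('a \<Rightarrow> 'a) \<Rightarrow> 'a pmf \<Rightarrow> 'a pmf" where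
  "push_forward X \<rho> p \<psi> = (\<lambda>\<mu>\<in>wasserstein_space X \<rho> p. map_pmf \<psi> \<mu>)"

lemma pmf_push_forward:
  assumes "\<psi> \<in> carrier (Isom X \<rho>)" "\<mu> \<in> wasserstein_space X \<rho> p" "x \<in> X"
  shows "pmf (push_forward X \<rho> p \<psi> \<mu>) x = pmf \<mu> (inv_into X \<psi> x)"
proof -
  have bij: "bij_betw \<psi> X X" using assms(1) by (simp add: Isom_def Bij_def)
  have supp: "set_pmf \<mu> \<subseteq> X" using assms(2) by (simp add: wasserstein_space_def)
  have y: "inv_into X \<psi> x \<in> X" "\<psi> (inv_into X \<psi> x) = x"
    using bij assms(3) by (auto simp: bij_betw_def intro: inv_into_into f_inv_into_f)
  have "measure \<mu> (\<psi> -` {x}) = measure \<mu> {inv_into X \<psi> x}"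
    using bij supp y by (intro measure_pmf.finite_measure_eq_AE AE_pmfI)
      (auto simp: bij_betw_def inj_on_def)
  then show ?thesis using assms(2) by (simp add: push_forward_def pmf_map measure_pmf_single)
qed

end

theory Submission
  imports Defs "HOL-Complex_Analysis.Great_Picard"
begin

text \<open>
  Write \<open>c(\<mu>,\<nu>) = d\<^sub>p(\<mu>,\<nu>)\<^sup>p\<close> for the optimal transport cost; an isometry preserves \<open>c\<close>. The metric
  sees the edges of the graph through midpoints. Call \<open>\<eta>\<close> a midpoint of \<open>\<mu>\<close> and \<open>\<nu>\<close> if
  \<open>c(\<mu>,\<eta>)\<close> and \<open>c(\<eta>,\<nu>)\<close> are both at most \<open>c(\<mu>,\<nu>)/2\<close>. Carrying out a random half of an
  optimal plan always gives one. If the plan moves mass between two different pairs of points, or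
  along a single pair that is not an edge, there is a second way of doing half of the work, hence a
  second midpoint. So the midpoint of \<open>\<mu> \<noteq> \<nu>\<close> is unique exactly if \<open>\<nu>\<close> arises from \<open>\<mu>\<close> by an
  \<^emph>\<open>edge move\<close>: a mass \<open>m\<close> is shifted along one edge from \<open>x\<close> to \<open>y\<close>
  (\<open>unique_midpoint_imp_edge_move\<close>, \<open>midpoint_edge_move_iff\<close>). Therefore an isometry \<open>\<Phi>\<close> sends
  edge moves to edge moves of the same mass (\<open>W_isometry_edge_move\<close>).

  If \<open>X\<close> has more than one point, the Dirac measures are exactly the sources of edge moves of
  mass \<open>1\<close>, so \<open>\<Phi>\<close> permutes the Dirac measures,
  and this defines an isometry \<open>\<psi>\<close> of \<open>X\<close>. After composing \<open>\<Phi>\<close> with the push-forward along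
  \<open>\<psi>\<^sup>-\<^sup>1\<close> it remains to see that an isometry which fixes every Dirac measure is the identity
  (\<open>W_isometry_fixing_diracs\<close>).

  Let \<open>x\<close> be in the support of \<open>\<mu>\<close> and move all of \<open>m = \<mu>(x)\<close> to a neighbour \<open>y\<close>. The image is an
  edge move of mass \<open>m\<close> from \<open>\<Phi>(\<mu>)\<close>, from some \<open>x'\<close> to some \<open>y'\<close>. Comparing distances to the
  fixed Dirac measures shows that the two edges are parallel: the functions
  \<open>\<rho>(z,y)\<^sup>p - \<rho>(z,x)\<^sup>p\<close> and \<open>\<rho>(z,y')\<^sup>p - \<rho>(z,x')\<^sup>p\<close> of \<open>z\<close> agree. Parallel edges may well be
  different when \<open>p = 1\<close>, as the opposite sides of a 4-cycle are. But the source \<open>x'\<close> does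
  not depend on the choice of the neighbour \<open>y\<close> (\<open>common_source\<close>), and if \<open>x' \<noteq> x\<close> then a
  neighbour \<open>y\<close> of \<open>x\<close> on a geodesic towards \<open>x'\<close> contradicts parallelism at \<open>z = x'\<close>.
  So \<open>x' = x\<close>, whence \<open>\<mu>(x) \<le> \<Phi>(\<mu>)(x)\<close> for all \<open>x\<close>, and the two probability measures coincide.
\<close>

section \<open>Discrete distributions\<close>

lemma integrable_pmf_iff_summable_on:
  fixes f :: "'b \<Rightarrow> real"
  assumes "\<And>x. x \<in> A \<Longrightarrow> 0 \<le> f x" and "set_pmf q \<subseteq> A"
  shows "integrable (measure_pmf q) f \<longleftrightarrow> (\<lambda>x. f x * pmf q x) summable_on A"
proof -
  have z: "pmf q x = 0" if "x \<notin> A" for x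
    using that assms(2) by (auto simp: set_pmf_iff)
  have "integrable (measure_pmf q) f \<longleftrightarrow> integrable (count_space UNIV) (\<lambda>x. pmf q x *\<^sub>R f x)"
    by (simp add: measure_pmf_eq_density integrable_density)
  also have "\<dots> \<longleftrightarrow> Infinite_Set_Sum.abs_summable_on (\<lambda>x. f x * pmf q x) UNIV"
    by (simp add: abs_summable_on_def mult.commute)
  also have "\<dots> \<longleftrightarrow> Infinite_Set_Sum.abs_summable_on (\<lambda>x. f x * pmf q x) A"
    using z by (intro abs_summable_on_cong_neutral) auto
  also have "\<dots> \<longleftrightarrow> (\<lambda>x. norm (f x * pmf q x)) summable_on A"
    by (subst abs_summable_equivalent[symmetric]) simp
  also have "\<dots> \<longleftrightarrow> (\<lambda>x. f x * pmf q x) summable_on A"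
    using assms(1) by (intro summable_on_cong) auto
  finally show ?thesis .
qed

text \<open>
  This identifies the sums in the definition of the Wasserstein distance with expectations. It also
  holds when the sum diverges: both sides are then \<open>0\<close> by convention.
\<close>
lemma infsum_pmf_eq_expectation:
  fixes f :: "'b \<Rightarrow> real"
  assumes "\<And>x. x \<in> A \<Longrightarrow> 0 \<le> f x" and "set_pmf q \<subseteq> A"
  shows "(\<Sum>\<^sub>\<infinity>x\<in>A. f x * pmf q x) = measure_pmf.expectation q f"
proof (cases "integrable (measure_pmf q) f")
  case False
  then show ?thesis
    using integrable_pmf_iff_summable_on[of A f q] assms
    by (auto simp: infsum_not_exists not_integrable_integral_eq)
next
  case True
  have z: "pmf q x = 0" if "x \<notin> A" for x
    using that assms(2) by (auto simp: set_pmf_iff)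
  have "(\<lambda>x. f x * pmf q x) summable_on A"
    using True integrable_pmf_iff_summable_on[of A f q] assms by blast
  then have "(\<lambda>x. norm (f x * pmf q x)) summable_on A"
    by (rule summable_on_cong[THEN iffD1, rotated]) (use assms(1) in auto)
  then have s: "Infinite_Set_Sum.abs_summable_on (\<lambda>x. f x * pmf q x) A"
    by (subst abs_summable_equivalent[symmetric]) simp
  have "measure_pmf.expectation q f = infsetsum (\<lambda>x. pmf q x * f x) UNIV"
    by (rule pmf_expectation_eq_infsetsum)
  also have "\<dots> = infsetsum (\<lambda>x. f x * pmf q x) A"
    using z by (intro infsetsum_cong_neutral) auto
  also have "\<dots> = (\<Sum>\<^sub>\<infinity>x\<in>A. f x * pmf q x)"
    using s by (rule infsetsum_infsum)
  finally show ?thesis by simp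
qed

text \<open>
  These two-point laws are the kernels that describe what happens to the mass of a single pair of
  points when a transport plan is carried out only in part.
\<close>
definition flip_pmf :: "real \<Rightarrow> 'b \<Rightarrow> 'b \<Rightarrow> 'b pmf" where
  "flip_pmf h a b = map_pmf (\<lambda>c. if c then a else b) (bernoulli_pmf h)"

lemma set_flip_pmf: "set_pmf (flip_pmf h a b) \<subseteq> {a, b}"
  by (auto simp: flip_pmf_def)

lemma pmf_flip_pmf:
  assumes "0 \<le> h" "h \<le> 1"
  shows "pmf (flip_pmf h a b) z = h * of_bool (z = a) + (1 - h) * of_bool (z = b)"
  using assms by (auto simp: flip_pmf_def map_pmf_def pmf_bind indicator_def)

lemma nn_integral_flip_pmf:
  assumes "0 \<le> h" "h \<le> 1" "\<And>z. 0 \<le> f z"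
  shows "(\<integral>\<^sup>+z. ennreal (f z) \<partial>measure_pmf (flip_pmf h a b)) = ennreal (h * f a + (1 - h) * f b)"
  using assms by (simp add: flip_pmf_def ennreal_mult ennreal_plus mult.commute)

lemma pmf_bind_flip_pmf:
  assumes "\<And>w. 0 \<le> h w" "\<And>w. h w \<le> 1"
  shows "pmf (bind_pmf \<pi> (\<lambda>w. flip_pmf (h w) (A w) (B w))) z
    = measure_pmf.expectation \<pi> (\<lambda>w. h w * of_bool (z = A w) + (1 - h w) * of_bool (z = B w))"
  using assms by (simp add: pmf_bind pmf_flip_pmf)

lemma integrable_pmf_bounded:
  fixes f :: "'b \<Rightarrow> real"
  assumes "\<And>w. \<bar>f w\<bar> \<le> c"
  shows "integrable (measure_pmf \<pi>) f"
  using assms by (intro measure_pmf.integrable_const_bound[where B = c]) auto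

lemma integrable_pmf_finite_support:
  fixes f :: "'b \<Rightarrow> real"
  assumes "finite F" "\<And>w. w \<notin> F \<Longrightarrow> f w = 0"
  shows "integrable (measure_pmf \<pi>) f"
proof (rule integrable_pmf_bounded)
  fix w
  show "\<bar>f w\<bar> \<le> (\<Sum>v\<in>F. \<bar>f v\<bar>)"
  proof (cases "w \<in> F")
    case True
    then show ?thesis using assms(1) by (intro member_le_sum[of w F "\<lambda>v. \<bar>f v\<bar>"]) auto
  qed (use assms in \<open>auto intro: sum_nonneg\<close>)
qed

lemma pmf_map_eq_expectation:
  "pmf (map_pmf f \<pi>) z = measure_pmf.expectation \<pi> (\<lambda>w. of_bool (z = f w))"
  by (simp add: map_pmf_def pmf_bind indicator_def of_bool_def eq_commute)

lemma pmf_eq_1_imp_return_pmf: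
  assumes "1 \<le> pmf q x"
  shows "q = return_pmf x"
proof -
  have "set_pmf q \<subseteq> {x}"
  proof
    fix y assume "y \<in> set_pmf q"
    show "y \<in> {x}"
    proof (rule ccontr)
      assume "y \<notin> {x}"
      then have "measure q {x, y} = pmf q x + pmf q y"
        by (simp add: measure_measure_pmf_finite)
      moreover have "measure q {x, y} \<le> 1" by (rule measure_pmf.prob_le_1)
      moreover have "0 < pmf q y" using \<open>y \<in> set_pmf q\<close> by (rule pmf_positive)
      ultimately show False using assms by simp
    qed
  qed
  then show ?thesis by (simp add: set_pmf_subset_singleton)
qed

lemma expectation_pmf_count_space:
  fixes f :: "'b \<Rightarrow> real"
  shows "integrable (measure_pmf q) f \<longleftrightarrow> integrable (count_space UNIV) (\<lambda>w. pmf q w * f w)"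
    and "measure_pmf.expectation q f = (\<integral>w. pmf q w * f w \<partial>count_space UNIV)"
  by (simp_all add: measure_pmf_eq_density integrable_density integral_density)

section \<open>Couplings\<close>

lemma ennreal_pmf_map_fst:
  "ennreal (pmf (map_pmf fst \<pi>) x) = (\<integral>\<^sup>+y. ennreal (pmf \<pi> (x, y)) \<partial>count_space UNIV)"
proof -
  have "(\<integral>\<^sup>+y. ennreal (pmf \<pi> (x, y)) \<partial>count_space UNIV)
      = (\<integral>\<^sup>+w. ennreal (pmf \<pi> w) \<partial>count_space (range (Pair x)))"
    by (rule nn_integral_bij_count_space) (auto simp: bij_betw_def inj_on_def)
  also have "\<dots> = emeasure (measure_pmf \<pi>) (range (Pair x))"
    by (rule nn_integral_pmf)
  also have "range (Pair x) = fst -` {x}" by auto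
  also have "emeasure (measure_pmf \<pi>) (fst -` {x}) = ennreal (pmf (map_pmf fst \<pi>) x)"
    by (simp add: pmf_map measure_pmf.emeasure_eq_measure)
  finally show ?thesis by simp
qed

lemma ennreal_pmf_map_snd:
  "ennreal (pmf (map_pmf snd \<pi>) y) = (\<integral>\<^sup>+x. ennreal (pmf \<pi> (x, y)) \<partial>count_space UNIV)"
proof -
  have "(\<integral>\<^sup>+x. ennreal (pmf \<pi> (x, y)) \<partial>count_space UNIV)
      = (\<integral>\<^sup>+w. ennreal (pmf \<pi> w) \<partial>count_space (range (\<lambda>x. (x, y))))"
    by (rule nn_integral_bij_count_space) (auto simp: bij_betw_def inj_on_def)
  also have "\<dots> = emeasure (measure_pmf \<pi>) (range (\<lambda>x. (x, y)))"
    by (rule nn_integral_pmf)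
  also have "range (\<lambda>x. (x, y)) = snd -` {y}" by auto
  also have "emeasure (measure_pmf \<pi>) (snd -` {y}) = ennreal (pmf (map_pmf snd \<pi>) y)"
    by (simp add: pmf_map measure_pmf.emeasure_eq_measure)
  finally show ?thesis by simp
qed

text \<open>
  Applied to the two projections, this bounds every coupling pointwise by either of its
  marginals.
\<close>
lemma pmf_le_pmf_map: "pmf \<pi> w \<le> pmf (map_pmf f \<pi>) (f w)"
proof -
  have "pmf \<pi> w = measure \<pi> {w}" by (simp add: measure_pmf_single)
  also have "\<dots> \<le> measure \<pi> (f -` {f w})"
    by (intro measure_pmf.finite_measure_mono) auto
  finally show ?thesis by (simp add: pmf_map)
qed

lemma nn_integral_pmf_limit:
  fixes f :: "nat \<Rightarrow> 'b \<Rightarrow> real"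
  assumes "\<And>n x. 0 \<le> f n x" and "\<And>n x. f n x \<le> pmf q x" and "\<And>x. (\<lambda>n. f n x) \<longlonglongrightarrow> g x"
    and "\<And>n. (\<integral>\<^sup>+x. ennreal (f n x) \<partial>count_space UNIV) = c"
  shows "(\<integral>\<^sup>+x. ennreal (g x) \<partial>count_space UNIV) = c"
proof -
  have "(\<lambda>n. \<integral>\<^sup>+x. ennreal (f n x) \<partial>count_space UNIV) \<longlonglongrightarrow> (\<integral>\<^sup>+x. ennreal (g x) \<partial>count_space UNIV)"
  proof (rule nn_integral_dominated_convergence[where w = "\<lambda>x. ennreal (pmf q x)"])
    show "(\<integral>\<^sup>+ x. ennreal (pmf q x) \<partial>count_space UNIV) < \<infinity>"
      by (simp add: nn_integral_pmf measure_pmf.emeasure_space_1[simplified] top.not_eq_extremum[symmetric])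
  qed (use assms in \<open>auto intro!: ennreal_leI tendsto_ennrealI AE_I2\<close>)
  then show ?thesis using assms(4) by (simp add: LIMSEQ_const_iff)
qed

text \<open>
  A pointwise convergent subsequence comes from a diagonal argument on the countable product of the
  supports. No mass escapes in the limit: for fixed \<open>x\<close> the entries \<open>\<pi> n (x, y)\<close> are dominated by
  the summable function \<open>\<nu>\<close> of \<open>y\<close>, and symmetrically in the other variable, so the marginals
  converge by dominated convergence.
\<close>
lemma couplings_sequentially_compact:
  fixes \<pi> :: "nat \<Rightarrow> ('b \<times> 'c) pmf"
  assumes "\<And>n. \<pi> n \<in> couplings \<mu> \<nu>"
  obtains \<pi>' r where "\<pi>' \<in> couplings \<mu> \<nu>" and "strict_mono (r :: nat \<Rightarrow> nat)"
    and "\<And>w. (\<lambda>n. pmf (\<pi> (r n)) w) \<longlonglongrightarrow> pmf \<pi>' w"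
proof -
  let ?S = "set_pmf \<mu> \<times> set_pmf \<nu>"
  have fst: "map_pmf fst (\<pi> n) = \<mu>" and snd: "map_pmf snd (\<pi> n) = \<nu>" for n
    using assms[of n] by (auto simp: couplings_def)
  have bound1: "pmf (\<pi> n) (x, y) \<le> pmf \<mu> x" and bound2: "pmf (\<pi> n) (x, y) \<le> pmf \<nu> y" for n x y
    using pmf_le_pmf_map[of "\<pi> n" "(x, y)" fst] pmf_le_pmf_map[of "\<pi> n" "(x, y)" snd] fst snd by auto
  obtain r where r: "strict_mono (r :: nat \<Rightarrow> nat)"
    and conv: "\<And>w. w \<in> ?S \<Longrightarrow> \<exists>l. (\<lambda>n. pmf (\<pi> (r n)) w) \<longlonglongrightarrow> l"
    by (rule function_convergent_subsequence[of ?S "\<lambda>n. pmf (\<pi> n)" 1]) (auto simp: pmf_le_1)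
  have "\<exists>l. (\<lambda>n. pmf (\<pi> (r n)) w) \<longlonglongrightarrow> l" for w
  proof (cases "w \<in> ?S")
    case False
    then have "pmf (\<pi> (r n)) w = 0" for n
      using bound1[of "r n" "fst w" "snd w"] bound2[of "r n" "fst w" "snd w"]
      by (cases w) (auto simp: set_pmf_iff intro!: antisym)
    then show ?thesis by auto
  qed (rule conv)
  then obtain g where g: "\<And>w. (\<lambda>n. pmf (\<pi> (r n)) w) \<longlonglongrightarrow> g w" by metis
  have g0: "0 \<le> g w" for w
    by (rule LIMSEQ_le_const[OF g]) auto
  have m1: "(\<integral>\<^sup>+y. ennreal (g (x, y)) \<partial>count_space UNIV) = ennreal (pmf \<mu> x)" for x
    by (rule nn_integral_pmf_limit[where f = "\<lambda>n y. pmf (\<pi> (r n)) (x, y)" and q = \<nu>])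
       (use g bound2 in \<open>auto simp: ennreal_pmf_map_fst[symmetric] fst\<close>)
  have m2: "(\<integral>\<^sup>+x. ennreal (g (x, y)) \<partial>count_space UNIV) = ennreal (pmf \<nu> y)" for y
    by (rule nn_integral_pmf_limit[where f = "\<lambda>n x. pmf (\<pi> (r n)) (x, y)" and q = \<mu>])
       (use g bound1 in \<open>auto simp: ennreal_pmf_map_snd[symmetric] snd\<close>)
  have total: "(\<integral>\<^sup>+w. ennreal (g w) \<partial>count_space UNIV) = 1"
    by (simp add: nn_integral_fst_count_space[symmetric] m1 nn_integral_pmf
        measure_pmf.emeasure_space_1[simplified])
  define \<pi>' where "\<pi>' = embed_pmf g"
  have pmf_\<pi>': "pmf \<pi>' w = g w" for w
    unfolding \<pi>'_def by (rule pmf_embed_pmf[OF g0 total])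
  have "map_pmf fst \<pi>' = \<mu>"
  proof (rule pmf_eqI)
    fix x
    have "ennreal (pmf (map_pmf fst \<pi>') x) = ennreal (pmf \<mu> x)"
      by (simp add: ennreal_pmf_map_fst pmf_\<pi>' m1)
    then show "pmf (map_pmf fst \<pi>') x = pmf \<mu> x" by simp
  qed
  moreover have "map_pmf snd \<pi>' = \<nu>"
  proof (rule pmf_eqI)
    fix y
    have "ennreal (pmf (map_pmf snd \<pi>') y) = ennreal (pmf \<nu> y)"
      by (simp add: ennreal_pmf_map_snd pmf_\<pi>' m2)
    then show "pmf (map_pmf snd \<pi>') y = pmf \<nu> y" by simp
  qed
  ultimately have "\<pi>' \<in> couplings \<mu> \<nu>" by (simp add: couplings_def)
  then show ?thesis using r g by (intro that[of \<pi>' r]) (auto simp: pmf_\<pi>')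
qed

lemma nn_integral_pmf_Fatou:
  fixes f :: "'b \<Rightarrow> ennreal"
  assumes "\<And>w. (\<lambda>n. pmf (\<pi> n) w) \<longlonglongrightarrow> pmf \<pi>' w"
  shows "(\<integral>\<^sup>+w. f w \<partial>measure_pmf \<pi>') \<le> liminf (\<lambda>n. \<integral>\<^sup>+w. f w \<partial>measure_pmf (\<pi> n))"
proof -
  have "(\<integral>\<^sup>+w. f w \<partial>measure_pmf \<pi>') = (\<integral>\<^sup>+w. ennreal (pmf \<pi>' w) * f w \<partial>count_space UNIV)"
    by (simp add: measure_pmf_eq_density nn_integral_density)
  also have "\<dots> \<le> (\<integral>\<^sup>+w. liminf (\<lambda>n. ennreal (pmf (\<pi> n) w) * f w) \<partial>count_space UNIV)"
  proof (intro nn_integral_mono)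
    fix w
    show "ennreal (pmf \<pi>' w) * f w \<le> liminf (\<lambda>n. ennreal (pmf (\<pi> n) w) * f w)"
    proof (cases "pmf \<pi>' w = 0")
      case False
      then have "(\<lambda>n. ennreal (pmf (\<pi> n) w) * f w) \<longlonglongrightarrow> ennreal (pmf \<pi>' w) * f w"
        using assms[of w] by (intro tendsto_mult_ennreal tendsto_ennrealI tendsto_const) auto
      then show ?thesis using lim_imp_Liminf[of sequentially] by fastforce
    qed auto
  qed
  also have "\<dots> \<le> liminf (\<lambda>n. \<integral>\<^sup>+w. ennreal (pmf (\<pi> n) w) * f w \<partial>count_space UNIV)"
    by (intro nn_integral_liminf) auto
  also have "\<dots> = liminf (\<lambda>n. \<integral>\<^sup>+w. f w \<partial>measure_pmf (\<pi> n))"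
    by (simp add: measure_pmf_eq_density nn_integral_density)
  finally show ?thesis .
qed

lemma couplings_return_pmf: "couplings (return_pmf z) \<mu> = {map_pmf (Pair z) \<mu>}"
proof
  show "{map_pmf (Pair z) \<mu>} \<subseteq> couplings (return_pmf z) \<mu>"
    by (auto simp: couplings_def map_pmf_comp)
  show "couplings (return_pmf z) \<mu> \<subseteq> {map_pmf (Pair z) \<mu>}"
  proof
    fix \<pi> assume \<pi>: "\<pi> \<in> couplings (return_pmf z) \<mu>"
    then have "set_pmf (map_pmf fst \<pi>) = {z}" by (simp add: couplings_def)
    then have "fst w = z" if "w \<in> set_pmf \<pi>" for w using that by auto
    then have "map_pmf (\<lambda>w. (z, snd w)) \<pi> = \<pi>"
      by (intro map_pmf_idI) (auto simp: prod_eq_iff)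
    moreover have "map_pmf (Pair z) \<mu> = map_pmf (\<lambda>w. (z, snd w)) \<pi>"
      using \<pi> by (auto simp: couplings_def map_pmf_comp)
    ultimately show "\<pi> \<in> {map_pmf (Pair z) \<mu>}" by simp
  qed
qed

section \<open>Geodesics in graph metric spaces\<close>

text \<open>
  The second vertex of a shortest path from \<open>x\<close> to \<open>y\<close> has this property. It is all that
  the rigidity proof uses about the graph; in particular, distinct points have distance at
  least \<open>1\<close>.
\<close>
lemma graph_metric_space_towards:
  assumes "graph_metric_space X \<rho>" and "x \<in> X" "y \<in> X" "x \<noteq> y"
  shows "\<exists>z\<in>X. \<rho> x z = 1 \<and> \<rho> z y = \<rho> x y - 1"
proof -
  interpret Metric_space X \<rho> using assms(1) by (simp add: graph_metric_space_def)
  obtain G where G: "pair_bidirected_digraph G" and X: "pverts G = X"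
    and conn: "Digraph_Component.connected (with_proj G)"
    and dist: "\<And>x y. x \<in> X \<Longrightarrow> y \<in> X \<Longrightarrow>
      \<rho> x y = real (LEAST n. \<exists>P. pre_digraph.apath (with_proj G) x P y \<and> length P = n)"
    using assms(1) unfolding graph_metric_space_def by blast
  interpret pair_bidirected_digraph G by (rule G)
  have short: "\<rho> u v \<le> real (length P)" if "apath u P v" "u \<in> X" "v \<in> X" for u v P
    using that by (subst dist) (auto intro!: Least_le)
  have "strongly_connected (with_proj G)"
    using symmetric_connected_imp_strongly_connected conn pair_sym_arcs by blast
  then have "x \<rightarrow>\<^sup>*\<^bsub>with_proj G\<^esub> y"
    using assms X by (simp add: strongly_connected_def)
  then obtain Q where "apath x Q y" by (auto simp: reachable_apath)
  then have "\<exists>n P. apath x P y \<and> length P = n" by blast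
  from LeastI_ex[OF this] obtain P where P: "apath x P y"
    and len: "real (length P) = \<rho> x y"
    using dist[OF assms(2,3)] by auto
  from P \<open>x \<noteq> y\<close> obtain e es where "P = e # es"
    by (cases P) (auto simp: apath_Nil_iff)
  with P have e: "e \<in> parcs G" "fst e = x" and es: "apath (snd e) es y"
    by (auto simp: apath_Cons_iff)
  define z where "z = snd e"
  have z: "z \<in> X" using e X arc_snd_in_verts by (auto simp: z_def)
  have "x \<noteq> z" using pair_no_loops[OF e(1)] e(2) by (simp add: z_def)
  then have "apath x [e] z"
    using e z X by (auto simp: apath_Cons_iff apath_Nil_iff z_def)
  then have 1: "\<rho> x z \<le> 1" using short assms(2) z by fastforce
  have 2: "\<rho> z y \<le> \<rho> x y - 1"
    using short[OF es] z assms(3) len \<open>P = e # es\<close> by (simp add: z_def)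
  have "\<rho> x y \<le> \<rho> x z + \<rho> z y" using assms z by (intro triangle)
  with 1 2 have "\<rho> x z = 1 \<and> \<rho> z y = \<rho> x y - 1" by linarith
  with z show ?thesis by blast
qed

section \<open>Optimal transport cost\<close>

locale graph_wasserstein = Metric_space X \<rho>
  for X :: "'a set" and \<rho> :: "'a \<Rightarrow> 'a \<Rightarrow> real" +
  fixes p :: real
  assumes p_ge_1: "1 \<le> p"
    and towards: "\<lbrakk>x \<in> X; y \<in> X; x \<noteq> y\<rbrakk> \<Longrightarrow> \<exists>z\<in>X. \<rho> x z = 1 \<and> \<rho> z y = \<rho> x y - 1"
begin

abbreviation W :: "'a pmf set" where "W \<equiv> wasserstein_space X \<rho> p"

definition cost :: "'a \<times> 'a \<Rightarrow> real" where
  "cost w = \<rho> (fst w) (snd w) powr p"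

definition plan_cost :: "('a \<times> 'a) pmf \<Rightarrow> real" where
  "plan_cost \<pi> = measure_pmf.expectation \<pi> cost"

definition opt_cost :: "'a pmf \<Rightarrow> 'a pmf \<Rightarrow> real" where
  "opt_cost \<mu> \<nu> = (INF \<pi>\<in>couplings \<mu> \<nu>. plan_cost \<pi>)"

lemma dist_ge_1: "1 \<le> \<rho> x y" if "x \<in> X" "y \<in> X" "x \<noteq> y"
proof -
  from towards[OF that] obtain z where "\<rho> z y = \<rho> x y - 1" by blast
  with nonneg[of z y] show ?thesis by linarith
qed

lemma cost_nonneg: "0 \<le> cost w"
  by (simp add: cost_def)

lemma cost_ge_1: "1 \<le> cost w" if "fst w \<in> X" "snd w \<in> X" "fst w \<noteq> snd w"
  using ge_one_powr_ge_zero[OF dist_ge_1[OF that]] p_ge_1 by (simp add: cost_def)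

lemma powr_triangle:
  assumes "x \<in> X" "y \<in> X" "z \<in> X"
  shows "\<rho> x z powr p \<le> 2 powr p * (\<rho> x y powr p + \<rho> y z powr p)"
proof -
  define m where "m = max (\<rho> x y) (\<rho> y z)"
  have m: "0 \<le> m" by (simp add: m_def le_max_iff_disj)
  have "\<rho> x z \<le> 2 * m" using triangle[OF assms] by (simp add: m_def)
  then have "\<rho> x z powr p \<le> (2 * m) powr p"
    using p_ge_1 by (intro powr_mono2) auto
  also have "\<dots> = 2 powr p * m powr p" using m by (simp add: powr_mult)
  also have "m powr p \<le> \<rho> x y powr p + \<rho> y z powr p"
    by (simp add: m_def max_def)
  finally show ?thesis by simp
qed

lemma W_iff:
  "\<mu> \<in> W \<longleftrightarrow> set_pmf \<mu> \<subseteq> X \<and> (\<exists>x0\<in>X. integrable (measure_pmf \<mu>) (\<lambda>x. \<rho> x x0 powr p))"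
  using integrable_pmf_iff_summable_on[of X "\<lambda>x. \<rho> x _ powr p" \<mu>]
  by (auto simp: wasserstein_space_def)

lemma W_subset: "\<mu> \<in> W \<Longrightarrow> set_pmf \<mu> \<subseteq> X"
  by (simp add: W_iff)

lemma W_integrable:
  assumes "\<mu> \<in> W" "y \<in> X"
  shows "integrable (measure_pmf \<mu>) (\<lambda>x. \<rho> x y powr p)"
proof -
  obtain x0 where x0: "x0 \<in> X" "integrable (measure_pmf \<mu>) (\<lambda>x. \<rho> x x0 powr p)"
    using assms(1) by (auto simp: W_iff)
  show ?thesis
  proof (rule Bochner_Integration.integrable_bound)
    show "integrable (measure_pmf \<mu>) (\<lambda>x. 2 powr p * (\<rho> x x0 powr p + \<rho> x0 y powr p))"
      using x0 by (intro integrable_mult_right Bochner_Integration.integrable_add) auto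
    show "AE x in measure_pmf \<mu>.
        norm (\<rho> x y powr p) \<le> norm (2 powr p * (\<rho> x x0 powr p + \<rho> x0 y powr p))"
      using W_subset[OF assms(1)] x0(1) assms(2)
      by (intro AE_pmfI) (auto intro!: powr_triangle)
  qed auto
qed

lemma coupling_in_X:
  assumes "\<pi> \<in> couplings \<mu> \<nu>" "\<mu> \<in> W" "set_pmf \<nu> \<subseteq> X" "w \<in> set_pmf \<pi>"
  shows "fst w \<in> X" "snd w \<in> X"
proof -
  have "fst w \<in> set_pmf \<mu>" "snd w \<in> set_pmf \<nu>"
    using assms(1,4) by (auto simp: couplings_def)
  then show "fst w \<in> X" "snd w \<in> X" using assms(2,3) W_subset by auto
qed

lemma integrable_cost:
  assumes "\<pi> \<in> couplings \<mu> \<nu>" "\<mu> \<in> W" "\<nu> \<in> W"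
  shows "integrable (measure_pmf \<pi>) cost"
proof -
  obtain x0 where x0: "x0 \<in> X" using assms(2) by (auto simp: W_iff)
  have "integrable (measure_pmf (map_pmf fst \<pi>)) (\<lambda>x. \<rho> x x0 powr p)"
    "integrable (measure_pmf (map_pmf snd \<pi>)) (\<lambda>x. \<rho> x x0 powr p)"
    using assms W_integrable x0 by (simp_all add: couplings_def del: integrable_map_pmf_eq)
  then have int: "integrable (measure_pmf \<pi>) (\<lambda>w. \<rho> (fst w) x0 powr p)"
    "integrable (measure_pmf \<pi>) (\<lambda>w. \<rho> (snd w) x0 powr p)" by simp_all
  show ?thesis
  proof (rule Bochner_Integration.integrable_bound)
    show "integrable (measure_pmf \<pi>) (\<lambda>w. 2 powr p * (\<rho> (fst w) x0 powr p + \<rho> (snd w) x0 powr p))"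
      using int by (intro integrable_mult_right Bochner_Integration.integrable_add)
    show "AE w in measure_pmf \<pi>.
        norm (cost w) \<le> norm (2 powr p * (\<rho> (fst w) x0 powr p + \<rho> (snd w) x0 powr p))"
      using coupling_in_X[OF assms(1,2) W_subset[OF assms(3)]] x0 powr_triangle[of _ x0]
      by (intro AE_pmfI) (auto simp: cost_def commute[of x0])
  qed auto
qed

lemma plan_cost_nonneg: "0 \<le> plan_cost \<pi>"
  unfolding plan_cost_def by (intro integral_nonneg_AE) (auto simp: cost_nonneg)

lemma bdd_below_plan_cost: "bdd_below (plan_cost ` A)"
  using plan_cost_nonneg by (auto intro!: bdd_belowI)

lemma opt_cost_le: "\<pi> \<in> couplings \<mu> \<nu> \<Longrightarrow> opt_cost \<mu> \<nu> \<le> plan_cost \<pi>"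
  unfolding opt_cost_def by (intro cINF_lower bdd_below_plan_cost)

lemma couplings_nonempty: "couplings \<mu> \<nu> \<noteq> {}"
proof -
  have "pair_pmf \<mu> \<nu> \<in> couplings \<mu> \<nu>"
    by (simp add: couplings_def map_fst_pair_pmf map_snd_pair_pmf)
  then show ?thesis by blast
qed

lemma opt_cost_nonneg: "0 \<le> opt_cost \<mu> \<nu>"
  unfolding opt_cost_def using couplings_nonempty plan_cost_nonneg by (intro cINF_greatest)

lemma nn_integral_cost:
  "integrable (measure_pmf \<pi>) cost \<Longrightarrow>
    (\<integral>\<^sup>+w. ennreal (cost w) \<partial>measure_pmf \<pi>) = ennreal (plan_cost \<pi>)"
  unfolding plan_cost_def by (intro nn_integral_eq_integral) (auto simp: cost_nonneg)

lemma wasserstein_dist_eq: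
  assumes "\<mu> \<in> W" "\<nu> \<in> W"
  shows "wasserstein_dist X \<rho> p \<mu> \<nu> = opt_cost \<mu> \<nu> powr (1 / p)"
proof -
  have "(\<Sum>\<^sub>\<infinity>(x, x')\<in>X \<times> X. \<rho> x x' powr p * pmf \<pi> (x, x')) = plan_cost \<pi>"
    if "\<pi> \<in> couplings \<mu> \<nu>" for \<pi>
  proof -
    have "(\<Sum>\<^sub>\<infinity>(x, x')\<in>X \<times> X. \<rho> x x' powr p * pmf \<pi> (x, x'))
        = (\<Sum>\<^sub>\<infinity>w\<in>X \<times> X. cost w * pmf \<pi> w)"
      by (intro infsum_cong) (auto simp: cost_def)
    also have "\<dots> = plan_cost \<pi>"
      unfolding plan_cost_def
      using coupling_in_X[OF that assms(1) W_subset[OF assms(2)]]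
      by (intro infsum_pmf_eq_expectation) (auto simp: cost_nonneg)
    finally show ?thesis .
  qed
  then show ?thesis by (simp add: wasserstein_dist_def opt_cost_def)
qed

lemma opt_cost_eq:
  assumes "\<mu> \<in> W" "\<nu> \<in> W"
  shows "opt_cost \<mu> \<nu> = wasserstein_dist X \<rho> p \<mu> \<nu> powr p"
  using p_ge_1 opt_cost_nonneg by (simp add: wasserstein_dist_eq[OF assms] powr_powr)

text \<open>
  Take the limit of a minimising sequence of couplings; Fatou's lemma makes the cost lower
  semicontinuous.
\<close>
lemma optimal_coupling:
  assumes "\<mu> \<in> W" "\<nu> \<in> W"
  obtains \<pi> where "\<pi> \<in> couplings \<mu> \<nu>" "plan_cost \<pi> = opt_cost \<mu> \<nu>"
proof -
  have "\<exists>\<pi>\<in>couplings \<mu> \<nu>. plan_cost \<pi> < opt_cost \<mu> \<nu> + 1 / Suc n" for n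
    unfolding opt_cost_def
    by (rule cINF_less_iff[OF couplings_nonempty bdd_below_plan_cost, THEN iffD1]) simp
  then obtain \<pi> where \<pi>: "\<And>n. \<pi> n \<in> couplings \<mu> \<nu>"
    and less: "\<And>n. plan_cost (\<pi> n) < opt_cost \<mu> \<nu> + 1 / Suc n" by metis
  obtain \<pi>' r where \<pi>': "\<pi>' \<in> couplings \<mu> \<nu>" and r: "strict_mono (r :: nat \<Rightarrow> nat)"
    and lim: "\<And>w. (\<lambda>n. pmf (\<pi> (r n)) w) \<longlonglongrightarrow> pmf \<pi>' w"
    using couplings_sequentially_compact[of \<pi>] \<pi> by blast
  have conv: "(\<lambda>n. plan_cost (\<pi> n)) \<longlonglongrightarrow> opt_cost \<mu> \<nu>"
  proof (rule tendsto_sandwich)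
    show "\<forall>\<^sub>F n in sequentially. opt_cost \<mu> \<nu> \<le> plan_cost (\<pi> n)"
      using opt_cost_le \<pi> by simp
    show "\<forall>\<^sub>F n in sequentially. plan_cost (\<pi> n) \<le> opt_cost \<mu> \<nu> + 1 / Suc n"
      using less by (simp add: less_imp_le)
    show "(\<lambda>n. opt_cost \<mu> \<nu> + 1 / Suc n) \<longlonglongrightarrow> opt_cost \<mu> \<nu>"
      using tendsto_add[OF tendsto_const LIMSEQ_inverse_real_of_nat, of "opt_cost \<mu> \<nu>"]
      by (simp add: inverse_eq_divide)
  qed auto
  have "ennreal (plan_cost \<pi>') = (\<integral>\<^sup>+w. ennreal (cost w) \<partial>measure_pmf \<pi>')"
    using nn_integral_cost integrable_cost[OF \<pi>' assms] by simp
  also have "\<dots> \<le> liminf (\<lambda>n. \<integral>\<^sup>+w. ennreal (cost w) \<partial>measure_pmf (\<pi> (r n)))"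
    by (rule nn_integral_pmf_Fatou[OF lim])
  also have "\<dots> = liminf (\<lambda>n. ennreal (plan_cost (\<pi> (r n))))"
    using nn_integral_cost integrable_cost[OF \<pi> assms] by simp
  also have "\<dots> = ennreal (opt_cost \<mu> \<nu>)"
    using LIMSEQ_subseq_LIMSEQ[OF conv r] 
    by (intro lim_imp_Liminf tendsto_ennrealI) (auto simp: o_def)
  finally have "plan_cost \<pi>' \<le> opt_cost \<mu> \<nu>"
    by (simp add: opt_cost_nonneg)
  then show ?thesis using opt_cost_le[OF \<pi>'] \<pi>' by (intro that) auto
qed

text \<open>
  A measure that is reached from the Wasserstein space at finite cost has finite \<open>p\<close>-th moment, so
  the measures constructed below by partial transport belong to the space.
\<close>
lemma coupling_bound:
  assumes "\<mu> \<in> W" "set_pmf \<eta> \<subseteq> X" "\<pi> \<in> couplings \<mu> \<eta>"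
    and bound: "(\<integral>\<^sup>+w. ennreal (cost w) \<partial>measure_pmf \<pi>) \<le> ennreal r" and "0 \<le> r"
  shows "\<eta> \<in> W" "opt_cost \<mu> \<eta> \<le> r"
proof -
  obtain x0 where x0: "x0 \<in> X" using assms(1) by (auto simp: W_iff)
  have cost: "integrable (measure_pmf \<pi>) cost"
    using bound by (intro integrableI_bounded) (auto simp: cost_nonneg le_less_trans)
  have "integrable (measure_pmf (map_pmf fst \<pi>)) (\<lambda>x. \<rho> x x0 powr p)"
    using assms W_integrable x0 by (simp add: couplings_def del: integrable_map_pmf_eq)
  then have int: "integrable (measure_pmf \<pi>) (\<lambda>w. \<rho> (fst w) x0 powr p)" by simp
  have "integrable (measure_pmf \<pi>) (\<lambda>w. \<rho> (snd w) x0 powr p)"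
  proof (rule Bochner_Integration.integrable_bound)
    show "integrable (measure_pmf \<pi>) (\<lambda>w. 2 powr p * (cost w + \<rho> (fst w) x0 powr p))"
      using int cost by (intro integrable_mult_right Bochner_Integration.integrable_add)
    have "\<rho> (snd w) x0 powr p \<le> 2 powr p * (cost w + \<rho> (fst w) x0 powr p)"
      if "w \<in> set_pmf \<pi>" for w
      using coupling_in_X[OF assms(3,1,2) that] x0 powr_triangle[of "snd w" "fst w" x0]
      by (simp add: cost_def commute[of "snd w"])
    then show "AE w in measure_pmf \<pi>.
        norm (\<rho> (snd w) x0 powr p) \<le> norm (2 powr p * (cost w + \<rho> (fst w) x0 powr p))"
      by (intro AE_pmfI) (auto simp: cost_nonneg)
  qed auto
  then have "integrable (measure_pmf (map_pmf snd \<pi>)) (\<lambda>x. \<rho> x x0 powr p)" by simp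
  then show "\<eta> \<in> W" using assms(2,3) x0 by (auto simp: W_iff couplings_def)
  have "ennreal (plan_cost \<pi>) \<le> ennreal r"
    using bound nn_integral_cost[OF cost] by simp
  then show "opt_cost \<mu> \<eta> \<le> r"
    using opt_cost_le[OF assms(3)] \<open>0 \<le> r\<close> by simp
qed

text \<open>
  Mass that has to enter \<open>S\<close> must travel a distance of at least \<open>1\<close>. In other words, the
  indicator of any set can serve as a Kantorovich potential, because distinct points have distance
  at least \<open>1\<close>.
\<close>
lemma opt_cost_ge_measure:
  assumes "\<mu> \<in> W" "\<nu> \<in> W"
  shows "measure \<nu> S - measure \<mu> S \<le> opt_cost \<mu> \<nu>"
proof -
  obtain \<pi> where \<pi>: "\<pi> \<in> couplings \<mu> \<nu>" and opt: "plan_cost \<pi> = opt_cost \<mu> \<nu>"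
    using optimal_coupling[OF assms] by blast
  have "measure \<nu> S - measure \<mu> S = measure \<pi> (snd -` S) - measure \<pi> (fst -` S)"
    using \<pi> by (auto simp: couplings_def)
  also have "\<dots> = measure_pmf.expectation \<pi> (\<lambda>w. indicator (snd -` S) w - indicator (fst -` S) w)"
    by (subst Bochner_Integration.integral_diff)
       (auto intro!: measure_pmf.integrable_const_bound[where B = 1])
  also have "\<dots> \<le> plan_cost \<pi>"
    unfolding plan_cost_def
  proof (rule integral_mono_AE)
    show "integrable (measure_pmf \<pi>)
        (\<lambda>w. indicator (snd -` S) w - indicator (fst -` S) w :: real)"
      by (intro Bochner_Integration.integrable_diff)
         (auto intro!: measure_pmf.integrable_const_bound[where B = 1])
    show "integrable (measure_pmf \<pi>) cost" by (rule integrable_cost[OF \<pi> assms])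
    have "indicator (snd -` S) w - indicator (fst -` S) w \<le> cost w" if "w \<in> set_pmf \<pi>" for w
      using cost_ge_1[OF coupling_in_X[OF \<pi> assms(1) W_subset[OF assms(2)] that]] cost_nonneg[of w]
      by (cases "fst w = snd w") (auto simp: indicator_def)
    then show "AE w in measure_pmf \<pi>.
        indicator (snd -` S) w - indicator (fst -` S) w \<le> cost w"
      by (intro AE_pmfI)
  qed
  finally show ?thesis using opt by simp
qed

end

section \<open>Edge moves are the pairs with a unique midpoint\<close>

text \<open>
  Superadditivity of the \<open>p\<close>-th power: a detour through a point on a geodesic does not cost more
  than the direct move.
\<close>
lemma one_plus_powr_le:
  fixes t q :: real
  assumes "0 \<le> t" "1 \<le> q"
  shows "1 + t powr q \<le> (1 + t) powr q"
proof -
  have "1 + t powr q = 1 + t * t powr (q - 1)"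
    using assms powr_mult_base[of t "q - 1"] by simp
  also have "\<dots> \<le> (1 + t) powr (q - 1) + t * (1 + t) powr (q - 1)"
    using assms by (intro add_mono mult_left_mono powr_mono2 ge_one_powr_ge_zero) auto
  also have "\<dots> = (1 + t) powr q"
    using assms powr_mult_base[of "1 + t" "q - 1"] by (simp add: distrib_right)
  finally show ?thesis .
qed

context graph_wasserstein
begin

text \<open>
  A pair \<open>w = (x, y)\<close> drawn from a coupling is replaced by an intermediate point, which is \<open>A w\<close>
  with probability \<open>h w\<close> and \<open>B w\<close> otherwise. Drawing both together couples \<open>\<mu>\<close> with the law \<open>\<eta>\<close>
  of the intermediate point.
\<close>
lemma interpolate_left:
  assumes "\<mu> \<in> W" "\<nu> \<in> W" "\<pi> \<in> couplings \<mu> \<nu>"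
    and h: "\<And>w. 0 \<le> h w" "\<And>w. h w \<le> 1"
    and AB: "\<And>w. w \<in> set_pmf \<pi> \<Longrightarrow> A w \<in> X \<and> B w \<in> X"
    and a: "integrable (measure_pmf \<pi>) a"
      "\<And>w. w \<in> set_pmf \<pi> \<Longrightarrow> h w * cost (fst w, A w) + (1 - h w) * cost (fst w, B w) = a w"
  defines "\<eta> \<equiv> bind_pmf \<pi> (\<lambda>w. flip_pmf (h w) (A w) (B w))"
  shows "\<eta> \<in> W" "opt_cost \<mu> \<eta> \<le> measure_pmf.expectation \<pi> a"
proof -
  define \<sigma> where "\<sigma> = bind_pmf \<pi> (\<lambda>w. map_pmf (Pair (fst w)) (flip_pmf (h w) (A w) (B w)))"
  have \<sigma>: "\<sigma> \<in> couplings \<mu> \<eta>"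
    using assms(3)
    by (simp add: \<sigma>_def \<eta>_def couplings_def map_bind_pmf map_pmf_comp map_pmf_const
        bind_return_pmf' map_pmf_def[symmetric])
  have \<eta>: "set_pmf \<eta> \<subseteq> X"
    using AB set_flip_pmf by (fastforce simp: \<eta>_def)
  have a0: "0 \<le> a w" if "w \<in> set_pmf \<pi>" for w
    using a(2)[OF that, symmetric] h[of w] by (auto intro!: add_nonneg_nonneg mult_nonneg_nonneg cost_nonneg)
  have "(\<integral>\<^sup>+w. ennreal (cost w) \<partial>measure_pmf \<sigma>) = (\<integral>\<^sup>+w. ennreal (a w) \<partial>measure_pmf \<pi>)"
    unfolding \<sigma>_def nn_integral_bind_pmf nn_integral_map_pmf
  proof (intro nn_integral_cong_AE AE_pmfI)
    fix w assume w: "w \<in> set_pmf \<pi>"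
    show "(\<integral>\<^sup>+z. ennreal (cost (fst w, z)) \<partial>measure_pmf (flip_pmf (h w) (A w) (B w))) = ennreal (a w)"
      using h cost_nonneg a(2)[OF w] by (simp add: nn_integral_flip_pmf)
  qed
  also have "\<dots> = ennreal (measure_pmf.expectation \<pi> a)"
    using a(1) a0 by (intro nn_integral_eq_integral AE_pmfI) auto
  finally have "(\<integral>\<^sup>+w. ennreal (cost w) \<partial>measure_pmf \<sigma>) \<le> ennreal (measure_pmf.expectation \<pi> a)"
    by simp
  moreover have "0 \<le> measure_pmf.expectation \<pi> a"
    using a0 by (intro integral_nonneg_AE AE_pmfI)
  ultimately show "\<eta> \<in> W" "opt_cost \<mu> \<eta> \<le> measure_pmf.expectation \<pi> a"
    using coupling_bound[OF assms(1) \<eta> \<sigma>] by blast+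
qed

lemma couplings_swap: "map_pmf prod.swap \<pi> \<in> couplings \<nu> \<mu>" if "\<pi> \<in> couplings \<mu> \<nu>"
  using that by (auto simp: couplings_def map_pmf_comp)

lemma cost_swap: "cost (prod.swap w) = cost w"
  by (simp add: cost_def commute)

lemma opt_cost_commute: "opt_cost \<mu> \<nu> = opt_cost \<nu> \<mu>" if "\<mu> \<in> W" "\<nu> \<in> W"
proof -
  have "opt_cost \<nu> \<mu> \<le> opt_cost \<mu> \<nu>" if W: "\<mu> \<in> W" "\<nu> \<in> W" for \<mu> \<nu>
  proof -
    obtain \<pi> where \<pi>: "\<pi> \<in> couplings \<mu> \<nu>" "plan_cost \<pi> = opt_cost \<mu> \<nu>"
      using optimal_coupling[OF W] by blast
    have "opt_cost \<nu> \<mu> \<le> plan_cost (map_pmf prod.swap \<pi>)"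
      by (intro opt_cost_le couplings_swap \<pi>)
    also have "\<dots> = plan_cost \<pi>" by (simp add: plan_cost_def cost_swap)
    finally show ?thesis using \<pi> by simp
  qed
  from this[OF that] this[OF that(2,1)] show ?thesis by simp
qed

lemma interpolate_right:
  assumes "\<mu> \<in> W" "\<nu> \<in> W" "\<pi> \<in> couplings \<mu> \<nu>"
    and h: "\<And>w. 0 \<le> h w" "\<And>w. h w \<le> 1"
    and AB: "\<And>w. w \<in> set_pmf \<pi> \<Longrightarrow> A w \<in> X \<and> B w \<in> X"
    and b: "integrable (measure_pmf \<pi>) b"
      "\<And>w. w \<in> set_pmf \<pi> \<Longrightarrow> h w * cost (A w, snd w) + (1 - h w) * cost (B w, snd w) = b w"
  defines "\<eta> \<equiv> bind_pmf \<pi> (\<lambda>w. flip_pmf (h w) (A w) (B w))"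
  shows "\<eta> \<in> W" "opt_cost \<eta> \<nu> \<le> measure_pmf.expectation \<pi> b"
proof -
  let ?\<pi> = "map_pmf prod.swap \<pi>"
  have \<eta>: "\<eta> = bind_pmf ?\<pi> (\<lambda>w. flip_pmf (h (prod.swap w)) (A (prod.swap w)) (B (prod.swap w)))"
    by (simp add: \<eta>_def bind_map_pmf)
  have cs: "cost (x, y) = cost (y, x)" for x y using cost_swap[of "(x, y)"] by simp
  have *: "integrable (measure_pmf ?\<pi>) (\<lambda>w. b (prod.swap w))" using b(1) by simp
  have "\<eta> \<in> W \<and> opt_cost \<nu> \<eta> \<le> measure_pmf.expectation ?\<pi> (\<lambda>w. b (prod.swap w))"
    unfolding \<eta> using h AB b(2) cs
    by (intro conjI interpolate_left[OF assms(2,1) couplings_swap[OF assms(3)] _ _ _ *]) auto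
  then show "\<eta> \<in> W" "opt_cost \<eta> \<nu> \<le> measure_pmf.expectation \<pi> b"
    using opt_cost_commute[OF _ assms(2)] by auto
qed

definition edge_move :: "real \<Rightarrow> 'a pmf \<Rightarrow> 'a pmf \<Rightarrow> 'a \<Rightarrow> 'a \<Rightarrow> bool" where
  "edge_move m \<mu> \<nu> x y \<longleftrightarrow> x \<in> X \<and> y \<in> X \<and> \<rho> x y = 1 \<and> 0 < m \<and>
     (\<forall>z. pmf \<nu> z = pmf \<mu> z + (if z = y then m else 0) - (if z = x then m else 0))"

text \<open>
  The two bounds are inequalities because \<open>opt_cost\<close> is the \<open>p\<close>-th power of a metric: for
  \<open>p > 1\<close> intermediate stops can make both halves cheaper than half of the whole.
\<close>
definition midpoint :: "'a pmf \<Rightarrow> 'a pmf \<Rightarrow> 'a pmf \<Rightarrow> bool" where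
  "midpoint \<mu> \<nu> \<eta> \<longleftrightarrow> \<eta> \<in> W \<and> opt_cost \<mu> \<eta> \<le> opt_cost \<mu> \<nu> / 2 \<and> opt_cost \<eta> \<nu> \<le> opt_cost \<mu> \<nu> / 2"

lemma edge_move_neq: "edge_move m \<mu> \<nu> x y \<Longrightarrow> x \<noteq> y"
  by (auto simp: edge_move_def)

lemma edge_move_le: "edge_move m \<mu> \<nu> x y \<Longrightarrow> m \<le> pmf \<mu> x"
  using pmf_nonneg[of \<nu> x] edge_move_neq[of m \<mu> \<nu> x y] by (auto simp: edge_move_def)

lemma edge_move_unique: "edge_move m \<mu> \<nu> x y \<Longrightarrow> edge_move m \<mu> \<nu>' x y \<Longrightarrow> \<nu> = \<nu>'"
  by (intro pmf_eqI) (auto simp: edge_move_def)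

text \<open>
  Every unit of mass at \<open>x\<close> moves to \<open>y\<close> with probability \<open>m / \<mu>(x)\<close>; this is an interpolation of
  the diagonal coupling of \<open>\<mu>\<close> with itself.
\<close>
lemma edge_move_exists:
  assumes "\<mu> \<in> W" "x \<in> X" "y \<in> X" "\<rho> x y = 1" "0 < m" "m \<le> pmf \<mu> x"
  obtains \<nu> where "\<nu> \<in> W" "edge_move m \<mu> \<nu> x y" "opt_cost \<mu> \<nu> \<le> m"
proof -
  define q where "q = m / pmf \<mu> x"
  define A where "A w = (if fst w = x then y else fst w)" for w :: "'a \<times> 'a"
  define a where "a w = (if w = (x, x) then q else 0)" for w :: "'a \<times> 'a"
  define \<pi> where "\<pi> = map_pmf (\<lambda>w. (w, w)) \<mu>"
  define \<nu> where "\<nu> = bind_pmf \<pi> (\<lambda>w. flip_pmf q (A w) (fst w))"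
  have q: "0 \<le> q" "q \<le> 1" and qm: "q * pmf \<mu> x = m" using assms by (auto simp: q_def)
  have neq: "x \<noteq> y" using assms by auto
  have \<pi>: "\<pi> \<in> couplings \<mu> \<mu>" by (simp add: \<pi>_def couplings_def map_pmf_comp)
  have in_X: "w \<in> X" if "w \<in> set_pmf \<mu>" for w using that W_subset[OF assms(1)] by auto
  have int: "integrable (measure_pmf \<pi>) a"
    by (rule integrable_pmf_finite_support[of "{(x, x)}"]) (auto simp: a_def)
  have "measure_pmf.expectation \<pi> a = (\<Sum>w\<in>{(x, x)}. a w * pmf \<pi> w)"
    by (rule integral_measure_pmf_real) (auto simp: a_def split: if_splits)
  also have "\<dots> = m"
    using qm pmf_map_inj'[of "\<lambda>w. (w, w)" \<mu> x] by (simp add: a_def \<pi>_def inj_on_def)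
  finally have exp: "measure_pmf.expectation \<pi> a = m" .
  have "\<nu> \<in> W \<and> opt_cost \<mu> \<nu> \<le> measure_pmf.expectation \<pi> a"
    unfolding \<nu>_def using q assms(3,4) in_X p_ge_1 
    by (intro conjI interpolate_left[OF assms(1,1) \<pi> _ _ _ int])
       (auto simp: A_def a_def \<pi>_def cost_def)
  moreover have "pmf \<nu> z = pmf \<mu> z + (if z = y then m else 0) - (if z = x then m else 0)" for z
  proof -
    have "pmf \<nu> z = measure_pmf.expectation \<mu>
        (\<lambda>w. q * of_bool (z = (if w = x then y else w)) + (1 - q) * of_bool (z = w))"
      unfolding \<nu>_def using q by (simp add: pmf_bind_flip_pmf A_def \<pi>_def cong: if_cong)
    also have "\<dots> = (\<Sum>w\<in>{z, x}. (q * of_bool (z = (if w = x then y else w))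
        + (1 - q) * of_bool (z = w)) * pmf \<mu> w)"
      by (rule integral_measure_pmf_real) (auto simp: of_bool_def split: if_splits)
    also have "\<dots> = pmf \<mu> z + (if z = y then m else 0) - (if z = x then m else 0)"
      using neq qm by (cases "z = x") (auto simp: algebra_simps)
    finally show ?thesis .
  qed
  ultimately show ?thesis using assms exp by (intro that[of \<nu>]) (auto simp: edge_move_def)
qed

lemma opt_cost_edge_move:
  assumes "\<mu> \<in> W" "\<nu> \<in> W" "edge_move m \<mu> \<nu> x y"
  shows "opt_cost \<mu> \<nu> = m"
proof (rule antisym)
  from assms(3) have e: "x \<in> X" "y \<in> X" "\<rho> x y = 1" "0 < m" by (auto simp: edge_move_def)
  obtain \<nu>' where "edge_move m \<mu> \<nu>' x y" "opt_cost \<mu> \<nu>' \<le> m"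
    using edge_move_exists[OF assms(1) e edge_move_le[OF assms(3)]] by blast
  then show "opt_cost \<mu> \<nu> \<le> m" using edge_move_unique[OF assms(3)] by simp
  have "m = pmf \<nu> y - pmf \<mu> y"
    using assms(3) edge_move_neq[OF assms(3)] by (auto simp: edge_move_def)
  also have "\<dots> \<le> opt_cost \<mu> \<nu>"
    using opt_cost_ge_measure[OF assms(1,2), of "{y}"] by (simp add: measure_pmf_single)
  finally show "m \<le> opt_cost \<mu> \<nu>" .
qed

text \<open>
  For every set \<open>S\<close> that contains \<open>y\<close> but not \<open>x\<close>, both halves of the way have to carry exactly
  mass \<open>m / 2\<close> into \<open>S\<close>, by \<open>opt_cost_ge_measure\<close>. The sets \<open>{y}\<close>, \<open>- {x}\<close> and \<open>{y, z}\<close> then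
  determine a midpoint at \<open>y\<close>, at \<open>x\<close> and at any other point \<open>z\<close>.
\<close>
lemma midpoint_edge_move_iff:
  assumes "\<mu> \<in> W" "\<nu> \<in> W" "edge_move m \<mu> \<nu> x y"
  shows "midpoint \<mu> \<nu> \<eta> \<longleftrightarrow> \<eta> \<in> W \<and> edge_move (m / 2) \<mu> \<eta> x y"
proof
  assume "\<eta> \<in> W \<and> edge_move (m / 2) \<mu> \<eta> x y"
  then have \<eta>: "\<eta> \<in> W" "edge_move (m / 2) \<mu> \<eta> x y" by auto
  then have "edge_move (m / 2) \<eta> \<nu> x y"
    using assms(3) by (auto simp: edge_move_def)
  then show "midpoint \<mu> \<nu> \<eta>"
    using \<eta> assms by (auto simp: midpoint_def opt_cost_edge_move)
next
  assume "midpoint \<mu> \<nu> \<eta>"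
  then have \<eta>: "\<eta> \<in> W" and le: "opt_cost \<mu> \<eta> \<le> m / 2" "opt_cost \<eta> \<nu> \<le> m / 2"
    using opt_cost_edge_move[OF assms] by (auto simp: midpoint_def)
  have 1: "measure \<eta> S - measure \<mu> S \<le> m / 2" for S
    using opt_cost_ge_measure[OF assms(1) \<eta>] le(1) by (rule order_trans)
  have 2: "measure \<nu> S - measure \<eta> S \<le> m / 2" for S
    using opt_cost_ge_measure[OF \<eta> assms(2)] le(2) by (rule order_trans)
  have neq: "x \<noteq> y" using edge_move_neq[OF assms(3)] .
  have \<nu>: "pmf \<nu> z = pmf \<mu> z + (if z = y then m else 0) - (if z = x then m else 0)" for z
    using assms(3) by (simp add: edge_move_def)
  have y: "pmf \<eta> y = pmf \<mu> y + m / 2"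
    using 1[of "{y}"] 2[of "{y}"] \<nu>[of y] neq by (simp add: measure_pmf_single)
  have compl: "measure (measure_pmf \<kappa>) (- {x}) = 1 - pmf \<kappa> x" for \<kappa>
    using measure_pmf.prob_compl[of "{x}" \<kappa>] by (simp add: Compl_eq_Diff_UNIV measure_pmf_single)
  have x: "pmf \<eta> x = pmf \<mu> x - m / 2"
    using 1[of "- {x}"] 2[of "- {x}"] \<nu>[of x] neq by (simp add: compl)
  have z: "pmf \<eta> z = pmf \<mu> z" if "z \<noteq> x" "z \<noteq> y" for z
    using 1[of "{y, z}"] 2[of "{y, z}"] \<nu>[of z] \<nu>[of y] neq that y
    by (simp add: measure_measure_pmf_finite)
  have "edge_move (m / 2) \<mu> \<eta> x y"
    using assms(3) x y z neq by (auto simp: edge_move_def)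
  with \<eta> show "\<eta> \<in> W \<and> edge_move (m / 2) \<mu> \<eta> x y" by blast
qed

lemma midpoint_edge_move_unique:
  assumes "\<mu> \<in> W" "\<nu> \<in> W" "edge_move m \<mu> \<nu> x y" "midpoint \<mu> \<nu> \<eta>" "midpoint \<mu> \<nu> \<eta>'"
  shows "\<eta> = \<eta>'"
  using midpoint_edge_move_iff[OF assms(1-3)] assms(4,5) edge_move_unique by blast

text \<open>
  The interpolation that stops each pair at either end with probability \<open>1/2\<close> is a midpoint. Change
  the stopping rule on finitely many pairs \<open>F\<close> without raising either of the two costs. The result is
  again a midpoint, so under uniqueness the change cannot affect the intermediate measure.
\<close>
lemma unique_midpoint_perturbation:
  assumes "\<mu> \<in> W" "\<nu> \<in> W" "\<pi> \<in> couplings \<mu> \<nu>" "plan_cost \<pi> = opt_cost \<mu> \<nu>"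
    and unique: "\<And>\<eta> \<eta>'. midpoint \<mu> \<nu> \<eta> \<Longrightarrow> midpoint \<mu> \<nu> \<eta>' \<Longrightarrow> \<eta> = \<eta>'"
    and "finite F"
    and off_F: "\<And>w. w \<notin> F \<Longrightarrow> A w = snd w \<and> B w = fst w \<and> h w = 1 / 2"
    and h: "\<And>w. 0 \<le> h w" "\<And>w. h w \<le> 1"
    and on_F: "\<And>w. w \<in> F \<Longrightarrow> A w \<in> X \<and> B w \<in> X"
    and left: "(\<Sum>w\<in>F. (h w * cost (fst w, A w) + (1 - h w) * cost (fst w, B w) - cost w / 2) * pmf \<pi> w) \<le> 0"
    and right: "(\<Sum>w\<in>F. (h w * cost (A w, snd w) + (1 - h w) * cost (B w, snd w) - cost w / 2) * pmf \<pi> w) \<le> 0"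
  shows "(\<Sum>w\<in>F. (h w * of_bool (z = A w) + (1 - h w) * of_bool (z = B w)
            - of_bool (z = snd w) / 2 - of_bool (z = fst w) / 2) * pmf \<pi> w) = 0"
proof -
  have in_X: "fst w \<in> X" "snd w \<in> X" if "w \<in> set_pmf \<pi>" for w
    using coupling_in_X[OF assms(3,1) W_subset[OF assms(2)] that] by auto
  have AB: "A w \<in> X \<and> B w \<in> X" if "w \<in> set_pmf \<pi>" for w
    using in_X[OF that] off_F[of w] on_F[of w] by (cases "w \<in> F") auto
  have int: "integrable (measure_pmf \<pi>) (\<lambda>w. cost w / 2)"
    using integrable_cost[OF assms(3,1,2)] by simp
  have diag: "cost (x, x) = 0" if "x \<in> X" for x
    using that p_ge_1 by (simp add: cost_def)
  have finE: "measure_pmf.expectation \<pi> (\<lambda>w. cost w / 2 + g w) = opt_cost \<mu> \<nu> / 2 + (\<Sum>w\<in>F. g w * pmf \<pi> w)"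
    and finI: "integrable (measure_pmf \<pi>) (\<lambda>w. cost w / 2 + g w)"
    if "\<And>w. w \<notin> F \<Longrightarrow> g w = 0" for g
  proof -
    have g: "integrable (measure_pmf \<pi>) g"
      using \<open>finite F\<close> that by (rule integrable_pmf_finite_support)
    then show "integrable (measure_pmf \<pi>) (\<lambda>w. cost w / 2 + g w)" using int by simp
    have "measure_pmf.expectation \<pi> g = (\<Sum>w\<in>F. g w * pmf \<pi> w)"
      using that by (intro integral_measure_pmf_real \<open>finite F\<close>) auto
    then show "measure_pmf.expectation \<pi> (\<lambda>w. cost w / 2 + g w) = opt_cost \<mu> \<nu> / 2 + (\<Sum>w\<in>F. g w * pmf \<pi> w)"
      using int g assms(4) by (simp add: plan_cost_def)
  qed
  \<comment> \<open>Deviation of the two conditional costs from those of the fair stopping rule.\<close>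
  define g1 where "g1 w = (if w \<in> F then
    h w * cost (fst w, A w) + (1 - h w) * cost (fst w, B w) - cost w / 2 else 0)" for w
  define g2 where "g2 w = (if w \<in> F then
    h w * cost (A w, snd w) + (1 - h w) * cost (B w, snd w) - cost w / 2 else 0)" for w
  have g1: "g1 w = 0" and g2: "g2 w = 0" if "w \<notin> F" for w
    using that by (simp_all add: g1_def g2_def)
  have eq1: "h w * cost (fst w, A w) + (1 - h w) * cost (fst w, B w) = cost w / 2 + g1 w"
    and eq2: "h w * cost (A w, snd w) + (1 - h w) * cost (B w, snd w) = cost w / 2 + g2 w"
    if "w \<in> set_pmf \<pi>" for w
    using off_F[of w] diag in_X[OF that] by (cases "w \<in> F"; simp add: g1_def g2_def)+
  define \<eta> where "\<eta> = bind_pmf \<pi> (\<lambda>w. flip_pmf (h w) (A w) (B w))"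
  define \<eta>0 where "\<eta>0 = bind_pmf \<pi> (\<lambda>w. flip_pmf (1 / 2) (snd w) (fst w))"
  have "\<eta> \<in> W \<and> opt_cost \<mu> \<eta> \<le> measure_pmf.expectation \<pi> (\<lambda>w. cost w / 2 + g1 w)"
    unfolding \<eta>_def using h AB eq1 g1
    by (intro conjI interpolate_left[OF assms(1-3) _ _ _ finI]; blast)
  moreover have "opt_cost \<eta> \<nu> \<le> measure_pmf.expectation \<pi> (\<lambda>w. cost w / 2 + g2 w)"
    unfolding \<eta>_def using h AB eq2 g2
    by (intro interpolate_right[OF assms(1-3) _ _ _ finI]; blast)
  ultimately have "midpoint \<mu> \<nu> \<eta>"
    using left right finE[of g1] finE[of g2] by (auto simp: midpoint_def g1_def g2_def)
  moreover have "\<eta>0 \<in> W \<and> opt_cost \<mu> \<eta>0 \<le> measure_pmf.expectation \<pi> (\<lambda>w. cost w / 2)"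
    unfolding \<eta>0_def using in_X diag
    by (intro conjI interpolate_left[OF assms(1-3) _ _ _ int]) auto
  moreover have "opt_cost \<eta>0 \<nu> \<le> measure_pmf.expectation \<pi> (\<lambda>w. cost w / 2)"
    unfolding \<eta>0_def using in_X diag
    by (intro interpolate_right[OF assms(1-3) _ _ _ int]) auto
  ultimately have "\<eta> = \<eta>0"
    using unique[of \<eta> \<eta>0] assms(4) by (auto simp: midpoint_def plan_cost_def)
  let ?f = "\<lambda>w. h w * of_bool (z = A w) + (1 - h w) * of_bool (z = B w) :: real"
  let ?g = "\<lambda>w. of_bool (z = snd w) / 2 + of_bool (z = fst w) / 2 :: real"
  have off: "?f w - ?g w = 0" if "w \<notin> F" for w
    using off_F[OF that] by simp
  have "\<bar>?f w\<bar> \<le> 2" for w using h[of w] by auto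
  then have f: "integrable (measure_pmf \<pi>) ?f" by (rule integrable_pmf_bounded)
  have f0: "integrable (measure_pmf \<pi>) ?g" by (rule integrable_pmf_bounded[of _ 1]) auto
  have "0 = measure_pmf.expectation \<pi> ?f - measure_pmf.expectation \<pi> ?g"
    using \<open>\<eta> = \<eta>0\<close> h pmf_bind_flip_pmf[of h \<pi> A B z] pmf_bind_flip_pmf[of "\<lambda>_. 1 / 2" \<pi> snd fst z]
    by (simp add: \<eta>_def \<eta>0_def)
  also have "\<dots> = measure_pmf.expectation \<pi> (\<lambda>w. ?f w - ?g w)"
    using f f0 by (rule Bochner_Integration.integral_diff[symmetric])
  also have "\<dots> = (\<Sum>w\<in>F. (?f w - ?g w) * pmf \<pi> w)"
    using off by (intro integral_measure_pmf_real \<open>finite F\<close>) blast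
  also have "\<dots> = (\<Sum>w\<in>F. (h w * of_bool (z = A w) + (1 - h w) * of_bool (z = B w)
            - of_bool (z = snd w) / 2 - of_bool (z = fst w) / 2) * pmf \<pi> w)"
    by (simp only: diff_diff_eq)
  finally show ?thesis by (rule sym)
qed

text \<open>
  An optimal plan can move mass between one pair of distinct points only: given two such pairs, one
  could advance the first a little more than half and the second a little less, at balanced cost.
  That pair must be an edge, since otherwise its mass could pause at a third point on a geodesic.
\<close>
lemma unique_midpoint_imp_edge_move:
  assumes "\<mu> \<in> W" "\<nu> \<in> W" "0 < opt_cost \<mu> \<nu>"
    and unique: "\<And>\<eta> \<eta>'. midpoint \<mu> \<nu> \<eta> \<Longrightarrow> midpoint \<mu> \<nu> \<eta>' \<Longrightarrow> \<eta> = \<eta>'"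
  shows "\<exists>x y. edge_move (opt_cost \<mu> \<nu>) \<mu> \<nu> x y"
proof -
  obtain \<pi> where \<pi>: "\<pi> \<in> couplings \<mu> \<nu>" and opt: "plan_cost \<pi> = opt_cost \<mu> \<nu>"
    using optimal_coupling[OF assms(1,2)] by blast
  note perturb = unique_midpoint_perturbation[OF assms(1,2) \<pi> opt unique]
  have in_X: "fst w \<in> X" "snd w \<in> X" if "w \<in> set_pmf \<pi>" for w
    using coupling_in_X[OF \<pi> assms(1) W_subset[OF assms(2)] that] by auto
  have diag: "cost (x, x) = 0" if "x \<in> X" for x
    using that p_ge_1 by (simp add: cost_def)
  have single: "P = Q" if P: "P \<in> set_pmf \<pi>" "fst P \<noteq> snd P" and Q: "Q \<in> set_pmf \<pi>" "fst Q \<noteq> snd Q" for P Q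
  proof (rule ccontr)
    assume "P \<noteq> Q"
    define u where "u = cost P * pmf \<pi> P"
    define v where "v = cost Q * pmf \<pi> Q"
    \<comment> \<open>Shifts by \<open>\<epsilon> / u\<close> and \<open>\<epsilon> / v\<close> change the cost by the same amount \<open>\<epsilon>\<close>; this \<open>\<epsilon>\<close> keeps the probabilities in \<open>[0, 1]\<close>.\<close>
    define \<epsilon> where "\<epsilon> = min u v / 2"
    have "1 \<le> cost P" "1 \<le> cost Q" using P Q in_X[OF P(1)] in_X[OF Q(1)] by (auto intro!: cost_ge_1)
    moreover have "0 < pmf \<pi> P" "0 < pmf \<pi> Q" using P Q by (auto simp: pmf_positive)
    ultimately have uv: "0 < u" "0 < v" by (auto simp: u_def v_def intro!: mult_pos_pos)
    then have \<epsilon>: "0 < \<epsilon>" "\<epsilon> / u \<le> 1 / 2" "\<epsilon> / v \<le> 1 / 2" by (auto simp: \<epsilon>_def field_simps)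
    then have \<epsilon>0: "0 < \<epsilon> / u" "0 < \<epsilon> / v" using uv by auto
    define h where "h w = (if w = P then 1 / 2 + \<epsilon> / u else if w = Q then 1 / 2 - \<epsilon> / v else 1 / 2)" for w
    have "1 / 2 + \<epsilon> / u \<le> 1" "0 \<le> 1 / 2 - \<epsilon> / v" using \<epsilon> by linarith+
    then have h01: "0 \<le> h w" "h w \<le> 1" for w
      using \<epsilon>0 by (simp_all add: h_def)
    have eP: "\<epsilon> / u * cost P * pmf \<pi> P = \<epsilon>" and eQ: "\<epsilon> / v * cost Q * pmf \<pi> Q = \<epsilon>"
      using uv by (auto simp: u_def v_def)
    have "(\<Sum>w\<in>{P, Q}. (h w * of_bool (z = snd w) + (1 - h w) * of_bool (z = fst w)
            - of_bool (z = snd w) / 2 - of_bool (z = fst w) / 2) * pmf \<pi> w) = 0" for z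
    proof (rule perturb)
      show "(\<Sum>w\<in>{P, Q}. (h w * cost (fst w, snd w) + (1 - h w) * cost (fst w, fst w) - cost w / 2) * pmf \<pi> w) \<le> 0"
        using \<open>P \<noteq> Q\<close> eP eQ in_X[OF P(1)] in_X[OF Q(1)] by (simp add: h_def diag algebra_simps)
      show "(\<Sum>w\<in>{P, Q}. (h w * cost (snd w, snd w) + (1 - h w) * cost (fst w, snd w) - cost w / 2) * pmf \<pi> w) \<le> 0"
        using \<open>P \<noteq> Q\<close> eP eQ in_X[OF P(1)] in_X[OF Q(1)] by (simp add: h_def diag algebra_simps)
    qed (use h01 in_X[OF P(1)] in_X[OF Q(1)] in \<open>auto simp: h_def\<close>)
    then have sum0: "(\<epsilon> / u * pmf \<pi> P) * (of_bool (z = snd P) - of_bool (z = fst P))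
        = (\<epsilon> / v * pmf \<pi> Q) * (of_bool (z = snd Q) - of_bool (z = fst Q))" for z
      using \<open>P \<noteq> Q\<close> by (simp add: h_def algebra_simps)
    have pos: "0 < \<epsilon> / u * pmf \<pi> P" "0 < \<epsilon> / v * pmf \<pi> Q"
      using \<epsilon>0 P Q by (intro mult_pos_pos; simp add: pmf_positive)+
    have "snd P = snd Q"
      using sum0[of "snd P"] P(2) pos by (auto simp: of_bool_def split: if_splits)
    moreover have "fst P = fst Q"
      using sum0[of "fst P"] P(2) pos by (auto simp: of_bool_def split: if_splits)
    ultimately show False using \<open>P \<noteq> Q\<close> by (simp add: prod_eq_iff)
  qed
  have "\<exists>P\<in>set_pmf \<pi>. fst P \<noteq> snd P"
  proof (rule ccontr)
    assume "\<not> (\<exists>P\<in>set_pmf \<pi>. fst P \<noteq> snd P)"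
    then have "cost w = 0" if "w \<in> set_pmf \<pi>" for w
      using that in_X diag by (metis prod.collapse)
    then have "plan_cost \<pi> = 0"
      unfolding plan_cost_def by (intro integral_eq_zero_AE AE_pmfI)
    with opt assms(3) show False by simp
  qed
  then obtain P where P: "P \<in> set_pmf \<pi>" "fst P \<noteq> snd P" by blast
  have off_P: "fst w = snd w" if "w \<in> set_pmf \<pi>" "w \<noteq> P" for w
    using single[OF P] that by blast
  define x where "x = fst P"
  define y where "y = snd P"
  have xy: "x \<in> X" "y \<in> X" "x \<noteq> y" using P in_X by (auto simp: x_def y_def)
  have Pxy: "P = (x, y)" by (simp add: x_def y_def)
  have "plan_cost \<pi> = (\<Sum>w\<in>{P}. cost w * pmf \<pi> w)"
    unfolding plan_cost_def
    using off_P in_X diag by (intro integral_measure_pmf_real) (auto, metis prod.collapse)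
  then have C: "opt_cost \<mu> \<nu> = cost P * pmf \<pi> P" using opt by simp
  have \<nu>: "pmf \<nu> z = pmf \<mu> z + (if z = y then pmf \<pi> P else 0) - (if z = x then pmf \<pi> P else 0)" for z
  proof -
    have "pmf \<nu> z - pmf \<mu> z = measure_pmf.expectation \<pi> (\<lambda>w. of_bool (z = snd w))
        - measure_pmf.expectation \<pi> (\<lambda>w. of_bool (z = fst w))"
      using \<pi> pmf_map_eq_expectation[of snd \<pi> z] pmf_map_eq_expectation[of fst \<pi> z]
      by (simp add: couplings_def)
    also have "\<dots> = measure_pmf.expectation \<pi> (\<lambda>w. of_bool (z = snd w) - of_bool (z = fst w))"
      by (rule Bochner_Integration.integral_diff[symmetric]; rule integrable_pmf_bounded[of _ 1]) auto
    also have "\<dots> = (\<Sum>w\<in>{P}. (of_bool (z = snd w) - of_bool (z = fst w)) * pmf \<pi> w)"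
      using off_P by (intro integral_measure_pmf_real) (auto simp: of_bool_def split: if_splits, metis+)
    finally show ?thesis by (auto simp: Pxy)
  qed
  have "\<rho> x y = 1"
  proof (rule ccontr)
    assume "\<rho> x y \<noteq> 1"
    obtain z where z: "z \<in> X" "\<rho> x z = 1" "\<rho> z y = \<rho> x y - 1"
      using towards[OF xy] by blast
    have "z \<noteq> y" "z \<noteq> x" using z xy \<open>\<rho> x y \<noteq> 1\<close> by auto
    then have "1 \<le> \<rho> z y" using z xy by (intro dist_ge_1)
    define K where "K = cost P"
    have K: "K = \<rho> x y powr p" by (simp add: K_def cost_def Pxy)
    have super: "1 + \<rho> z y powr p \<le> K"
      using one_plus_powr_le[of "\<rho> z y" p] z p_ge_1 \<open>1 \<le> \<rho> z y\<close> by (simp add: K)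
    moreover have "1 \<le> \<rho> z y powr p"
      using \<open>1 \<le> \<rho> z y\<close> p_ge_1 by (intro ge_one_powr_ge_zero) auto
    ultimately have K2: "2 \<le> K" by simp
    \<comment> \<open>Send all of the mass of \<open>P\<close> ahead, to \<open>z\<close> with probability \<open>b\<close> and to \<open>y\<close> otherwise. The cost
      from \<open>x\<close> is \<open>b + (1 - b) * K\<close>, and \<open>b\<close> is chosen to make this equal to \<open>K / 2\<close>.\<close>
    define b where "b = K / (2 * (K - 1))"
    have b: "0 < b" "b \<le> 1" "b * (K - 1) = K / 2" using K2 by (auto simp: b_def field_simps)
    define h where "h w = (if w = P then b else 1 / 2)" for w
    define A where "A w = (if w = P then z else snd w)" for w
    define B where "B w = (if w = P then y else fst w)" for w
    have "b * \<rho> z y powr p \<le> b * (K - 1)" using super b by (intro mult_left_mono) auto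
    then have "b * \<rho> z y powr p \<le> K / 2" using b by simp
    then have right: "b * cost (z, y) + (1 - b) * cost (y, y) - cost P / 2 \<le> 0"
      using diag[OF xy(2)] by (simp add: K_def) (simp add: cost_def)
    have left: "b * cost (x, z) + (1 - b) * cost (x, y) - cost P / 2 \<le> 0"
      using b z by (simp add: K_def[symmetric] Pxy[symmetric]) (simp add: cost_def algebra_simps)
    have "(\<Sum>w\<in>{P}. (h w * of_bool (z = A w) + (1 - h w) * of_bool (z = B w)
            - of_bool (z = snd w) / 2 - of_bool (z = fst w) / 2) * pmf \<pi> w) = 0"
    proof (rule perturb)
      show "(\<Sum>w\<in>{P}. (h w * cost (fst w, A w) + (1 - h w) * cost (fst w, B w) - cost w / 2) * pmf \<pi> w) \<le> 0"
        using mult_right_mono[OF left, of "pmf \<pi> P"] by (simp add: h_def A_def B_def x_def)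
      show "(\<Sum>w\<in>{P}. (h w * cost (A w, snd w) + (1 - h w) * cost (B w, snd w) - cost w / 2) * pmf \<pi> w) \<le> 0"
        using mult_right_mono[OF right, of "pmf \<pi> P"] by (simp add: h_def A_def B_def y_def)
    qed (use b xy z in \<open>auto simp: h_def A_def B_def\<close>)
    then have "b * pmf \<pi> P = 0"
      using \<open>z \<noteq> y\<close> \<open>z \<noteq> x\<close> by (simp add: h_def A_def B_def x_def y_def)
    then show False using b P by (simp add: set_pmf_iff)
  qed
  moreover from this have "opt_cost \<mu> \<nu> = pmf \<pi> P" by (simp add: C cost_def Pxy)
  ultimately have "edge_move (opt_cost \<mu> \<nu>) \<mu> \<nu> x y"
    using xy \<nu> assms(3) by (auto simp: edge_move_def)
  then show ?thesis by blast
qed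

end

section \<open>Isometries that fix the Dirac measures\<close>

context graph_wasserstein
begin

lemma opt_cost_return_pmf:
  "opt_cost (return_pmf z) \<mu> = measure_pmf.expectation \<mu> (\<lambda>w. \<rho> z w powr p)"
  by (simp add: opt_cost_def couplings_return_pmf plan_cost_def cost_def)

lemma opt_cost_return_return: "opt_cost (return_pmf x) (return_pmf y) = \<rho> x y powr p"
  by (simp add: opt_cost_return_pmf)

lemma return_pmf_in_W: "x \<in> X \<Longrightarrow> return_pmf x \<in> W"
  by (auto simp: W_iff intro!: integrable_measure_pmf_finite)

text \<open>
  The cost of transport from a Dirac measure is linear in the target.
\<close>
lemma opt_cost_return_edge_move:
  assumes "\<mu> \<in> W" "\<nu> \<in> W" "edge_move m \<mu> \<nu> x y" "z \<in> X"
  shows "opt_cost (return_pmf z) \<nu> - opt_cost (return_pmf z) \<mu> = m * (\<rho> z y powr p - \<rho> z x powr p)"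
proof -
  let ?f = "\<lambda>w. \<rho> z w powr p"
  let ?c = "count_space UNIV :: 'a measure"
  have \<nu>: "pmf \<nu> w = pmf \<mu> w + (if w = y then m else 0) - (if w = x then m else 0)" for w
    using assms(3) by (simp add: edge_move_def)
  have int: "integrable ?c (\<lambda>w. pmf \<mu> w * ?f w)" "integrable ?c (\<lambda>w. pmf \<nu> w * ?f w)"
    using W_integrable[OF assms(1,4)] W_integrable[OF assms(2,4)]
    by (simp_all add: commute[of z] expectation_pmf_count_space(1)[symmetric])
  have "opt_cost (return_pmf z) \<nu> - opt_cost (return_pmf z) \<mu>
      = (\<integral>w. pmf \<nu> w * ?f w - pmf \<mu> w * ?f w \<partial>?c)"
    using int by (simp add: opt_cost_return_pmf expectation_pmf_count_space(2))
  also have "\<dots> = (\<integral>w. indicator {y} w * (m * ?f y) - indicator {x} w * (m * ?f x) \<partial>?c)"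
    by (intro Bochner_Integration.integral_cong) (auto simp: \<nu> indicator_def algebra_simps)
  also have "\<dots> = m * ?f y - m * ?f x"
    by (subst Bochner_Integration.integral_diff) (auto simp: measure_def)
  finally show ?thesis by (simp add: algebra_simps)
qed

definition W_isometry :: "('a pmf \<Rightarrow> 'a pmf) \<Rightarrow> bool" where
  "W_isometry \<Phi> \<longleftrightarrow> bij_betw \<Phi> W W \<and> (\<forall>\<mu>\<in>W. \<forall>\<nu>\<in>W. opt_cost (\<Phi> \<mu>) (\<Phi> \<nu>) = opt_cost \<mu> \<nu>)"

lemma W_isometry_in_W: "W_isometry \<Phi> \<Longrightarrow> \<mu> \<in> W \<Longrightarrow> \<Phi> \<mu> \<in> W"
  by (auto simp: W_isometry_def bij_betw_def)

lemma W_isometry_opt_cost: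
  "W_isometry \<Phi> \<Longrightarrow> \<mu> \<in> W \<Longrightarrow> \<nu> \<in> W \<Longrightarrow> opt_cost (\<Phi> \<mu>) (\<Phi> \<nu>) = opt_cost \<mu> \<nu>"
  by (simp add: W_isometry_def)

lemma W_isometry_inv:
  assumes "W_isometry \<Phi>"
  shows "W_isometry (inv_into W \<Phi>)"
    and "\<mu> \<in> W \<Longrightarrow> \<Phi> (inv_into W \<Phi> \<mu>) = \<mu>" "\<mu> \<in> W \<Longrightarrow> inv_into W \<Phi> (\<Phi> \<mu>) = \<mu>"
proof -
  have bij: "bij_betw \<Phi> W W" using assms by (simp add: W_isometry_def)
  show right: "\<Phi> (inv_into W \<Phi> \<mu>) = \<mu>" if "\<mu> \<in> W" for \<mu>
    using bij_betw_inv_into_right[OF bij that] .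
  show "inv_into W \<Phi> (\<Phi> \<mu>) = \<mu>" if "\<mu> \<in> W" for \<mu>
    using bij_betw_inv_into_left[OF bij that] .
  have "bij_betw (inv_into W \<Phi>) W W" by (rule bij_betw_inv_into[OF bij])
  moreover from this have "inv_into W \<Phi> \<mu> \<in> W" if "\<mu> \<in> W" for \<mu>
    using that by (auto simp: bij_betw_def)
  moreover from this have "opt_cost (inv_into W \<Phi> \<mu>) (inv_into W \<Phi> \<nu>) = opt_cost \<mu> \<nu>"
    if "\<mu> \<in> W" "\<nu> \<in> W" for \<mu> \<nu>
    using W_isometry_opt_cost[OF assms, of "inv_into W \<Phi> \<mu>" "inv_into W \<Phi> \<nu>"] right that by simp
  ultimately show "W_isometry (inv_into W \<Phi>)" by (simp add: W_isometry_def)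
qed

lemma W_isometry_comp:
  assumes \<Phi>: "W_isometry \<Phi>" and \<Psi>: "W_isometry \<Psi>"
  shows "W_isometry (\<Psi> \<circ> \<Phi>)"
proof -
  have "bij_betw (\<Psi> \<circ> \<Phi>) W W"
    using assms bij_betw_trans by (auto simp: W_isometry_def)
  then show ?thesis
    using W_isometry_opt_cost[OF \<Phi>] W_isometry_opt_cost[OF \<Psi>] W_isometry_in_W[OF \<Phi>]
    by (simp add: W_isometry_def)
qed

lemma W_isometry_midpoint:
  assumes "W_isometry \<Phi>" "\<mu> \<in> W" "\<nu> \<in> W" "\<eta> \<in> W"
  shows "midpoint (\<Phi> \<mu>) (\<Phi> \<nu>) (\<Phi> \<eta>) \<longleftrightarrow> midpoint \<mu> \<nu> \<eta>"
  using assms by (simp add: midpoint_def W_isometry_opt_cost W_isometry_in_W)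

lemma W_isometry_edge_move:
  assumes \<Phi>: "W_isometry \<Phi>" and W: "\<mu> \<in> W" "\<nu> \<in> W" and em: "edge_move m \<mu> \<nu> x y"
  obtains x' y' where "edge_move m (\<Phi> \<mu>) (\<Phi> \<nu>) x' y'"
proof -
  have m: "opt_cost (\<Phi> \<mu>) (\<Phi> \<nu>) = m" "0 < m"
    using opt_cost_edge_move[OF W em] em W_isometry_opt_cost[OF \<Phi> W] by (auto simp: edge_move_def)
  have "\<eta> = \<eta>'" if mid: "midpoint (\<Phi> \<mu>) (\<Phi> \<nu>) \<eta>" "midpoint (\<Phi> \<mu>) (\<Phi> \<nu>) \<eta>'" for \<eta> \<eta>'
  proof -
    have in_W: "\<eta> \<in> W" "\<eta>' \<in> W" using mid by (auto simp: midpoint_def)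
    define \<theta> where "\<theta> = inv_into W \<Phi> \<eta>"
    define \<theta>' where "\<theta>' = inv_into W \<Phi> \<eta>'"
    have \<theta>: "\<theta> \<in> W" "\<theta>' \<in> W" "\<Phi> \<theta> = \<eta>" "\<Phi> \<theta>' = \<eta>'"
      using W_isometry_inv[OF \<Phi>] W_isometry_in_W in_W by (auto simp: \<theta>_def \<theta>'_def)
    then have "midpoint \<mu> \<nu> \<theta>" "midpoint \<mu> \<nu> \<theta>'"
      using mid W_isometry_midpoint[OF \<Phi> W] by auto
    then show ?thesis using midpoint_edge_move_unique[OF W em] \<theta> by blast
  qed
  then show ?thesis
    using unique_midpoint_imp_edge_move[of "\<Phi> \<mu>" "\<Phi> \<nu>"] W_isometry_in_W[OF \<Phi>] W m that by auto
qed

lemma neighbour_exists: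
  assumes "x \<in> X" "X \<noteq> {x}"
  obtains y where "y \<in> X" "\<rho> x y = 1"
  using assms towards by blast

text \<open>
  A Dirac measure at \<open>x\<close> is the source of an edge move of mass \<open>1\<close>, if \<open>x\<close> has a neighbour. Since the
  image is again the source of an edge move of mass \<open>1\<close>, all of its mass sits at one point.
\<close>
lemma W_isometry_return_pmf:
  assumes \<Phi>: "W_isometry \<Phi>" and "x \<in> X"
  obtains x' where "x' \<in> X" "\<Phi> (return_pmf x) = return_pmf x'"
proof (cases "X = {x}")
  case True
  \<comment> \<open>On a one-point space there is only one measure.\<close>
  have "set_pmf (\<Phi> (return_pmf x)) \<subseteq> {x}"
    using W_subset[OF W_isometry_in_W[OF \<Phi> return_pmf_in_W[OF assms(2)]]] True by simp
  then show ?thesis using that assms(2) by (simp add: set_pmf_subset_singleton)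
next
  case False
  obtain y where y: "y \<in> X" "\<rho> x y = 1" using neighbour_exists[OF assms(2) False] .
  then have "edge_move 1 (return_pmf x) (return_pmf y) x y"
    using assms(2) by (auto simp: edge_move_def indicator_def)
  then obtain x' y' where em: "edge_move 1 (\<Phi> (return_pmf x)) (\<Phi> (return_pmf y)) x' y'"
    using W_isometry_edge_move[OF \<Phi> return_pmf_in_W return_pmf_in_W] assms(2) y(1) by blast
  show ?thesis
    using that pmf_eq_1_imp_return_pmf[OF edge_move_le[OF em]] em by (auto simp: edge_move_def)
qed

text \<open>
  For \<open>p = 1\<close> this is a form of the Djokovic--Winkler relation between directed edges.
\<close>
definition parallel :: "'a \<Rightarrow> 'a \<Rightarrow> 'a \<Rightarrow> 'a \<Rightarrow> bool" where
  "parallel x y x' y' \<longleftrightarrow>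
    (\<forall>z\<in>X. \<rho> z y powr p - \<rho> z x powr p = \<rho> z y' powr p - \<rho> z x' powr p)"

lemma parallel_trans: "parallel x y x' y' \<Longrightarrow> parallel x' y' a b \<Longrightarrow> parallel x y a b"
  by (simp add: parallel_def)

text \<open>
  An edge that enters \<open>x\<close> is not parallel to one that leaves \<open>x\<close>: test at \<open>z = x\<close>.
\<close>
lemma parallel_head_neq_tail:
  assumes "parallel x y a b" "x \<in> X" "\<rho> x y = 1" "\<rho> a b = 1"
  shows "b \<noteq> x"
proof
  assume "b = x"
  then have "\<rho> x y powr p - \<rho> x x powr p = \<rho> x x powr p - \<rho> x a powr p"
    using assms(1,2) by (simp add: parallel_def)
  then show False using assms \<open>b = x\<close> commute[of x a] by simp
qed

lemma W_isometry_parallel: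
  assumes \<Phi>: "W_isometry \<Phi>" and fix_dirac: "\<And>z. z \<in> X \<Longrightarrow> \<Phi> (return_pmf z) = return_pmf z"
    and W: "\<mu> \<in> W" "\<nu> \<in> W" and em: "edge_move m \<mu> \<nu> x y" "edge_move m (\<Phi> \<mu>) (\<Phi> \<nu>) x' y'"
  shows "parallel x y x' y'"
  unfolding parallel_def
proof
  fix z assume z: "z \<in> X"
  have "opt_cost (return_pmf z) (\<Phi> \<kappa>) = opt_cost (return_pmf z) \<kappa>" if "\<kappa> \<in> W" for \<kappa>
    using W_isometry_opt_cost[OF \<Phi> return_pmf_in_W[OF z] that] fix_dirac[OF z] by simp
  then have "m * (\<rho> z y powr p - \<rho> z x powr p) = m * (\<rho> z y' powr p - \<rho> z x' powr p)"
    using opt_cost_return_edge_move[OF W em(1) z]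
      opt_cost_return_edge_move[OF W_isometry_in_W[OF \<Phi> W(1)] W_isometry_in_W[OF \<Phi> W(2)] em(2) z] W
    by simp
  then show "\<rho> z y powr p - \<rho> z x powr p = \<rho> z y' powr p - \<rho> z x' powr p"
    using em(1) by (simp add: edge_move_def)
qed

text \<open>
  Suppose that the images of the two full moves out of \<open>x\<close> had different sources \<open>x1\<close> and \<open>x2\<close>. The
  image side then has enough mass to perform half of the first move and all of the second. Pulling the
  result \<open>\<zeta>\<close> back by the inverse isometry gives a measure that is reached in two ways by edge moves
  parallel to the given ones: from \<open>\<nu>'\<close>, which has no mass left at \<open>x\<close>, by a move of mass \<open>m / 2\<close>,
  and from the measure \<open>\<eta>\<close> with mass \<open>m / 2\<close> at \<open>x\<close> by a move of mass \<open>m\<close>. By parallelism neither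
  move brings mass to \<open>x\<close>. The first way leaves mass \<open>0\<close> at \<open>x\<close>, while the second leaves \<open>m / 2\<close> or
  \<open>- m / 2\<close>.
\<close>
lemma common_source:
  assumes \<Phi>: "W_isometry \<Phi>" and fix_dirac: "\<And>z. z \<in> X \<Longrightarrow> \<Phi> (return_pmf z) = return_pmf z"
    and W: "\<mu> \<in> W" "\<nu> \<in> W" "\<nu>' \<in> W" and m: "m = pmf \<mu> x"
    and em: "edge_move m \<mu> \<nu> x y" "edge_move m \<mu> \<nu>' x v"
    and em': "edge_move m (\<Phi> \<mu>) (\<Phi> \<nu>) x1 y1" "edge_move m (\<Phi> \<mu>) (\<Phi> \<nu>') x2 y2"
  shows "x1 = x2"
proof (rule ccontr)
  assume "x1 \<noteq> x2"
  let ?\<Psi> = "inv_into W \<Phi>"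
  note inv = W_isometry_inv[OF \<Phi>]
  have fix_inv: "?\<Psi> (return_pmf z) = return_pmf z" if "z \<in> X" for z
    using inv(3)[OF return_pmf_in_W[OF that]] fix_dirac[OF that] by simp
  have e: "x \<in> X" "y \<in> X" "\<rho> x y = 1" "0 < m" "\<rho> x v = 1" using em by (auto simp: edge_move_def)
  have neq: "x \<noteq> y" "x \<noteq> v" using edge_move_neq em by blast+
  obtain \<eta> where \<eta>: "\<eta> \<in> W" "edge_move (m / 2) \<mu> \<eta> x y"
    by (rule edge_move_exists[OF W(1) e(1-3), of "m / 2"]) (use e m in auto)
  have "midpoint (\<Phi> \<mu>) (\<Phi> \<nu>) (\<Phi> \<eta>)"
    using \<eta> midpoint_edge_move_iff[OF W(1,2) em(1)] W_isometry_midpoint[OF \<Phi> W(1,2)] by blast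
  then have \<Phi>\<eta>: "edge_move (m / 2) (\<Phi> \<mu>) (\<Phi> \<eta>) x1 y1" "\<Phi> \<eta> \<in> W"
    using midpoint_edge_move_iff[OF _ _ em'(1)] W_isometry_in_W[OF \<Phi>] W by blast+
  have "m \<le> pmf (\<Phi> \<eta>) x2"
    using edge_move_le[OF em'(2)] \<Phi>\<eta>(1) \<open>x1 \<noteq> x2\<close> by (auto simp: edge_move_def)
  moreover have "x2 \<in> X" "y2 \<in> X" "\<rho> x2 y2 = 1" using em'(2) by (auto simp: edge_move_def)
  ultimately obtain \<zeta> where \<zeta>: "\<zeta> \<in> W" "edge_move m (\<Phi> \<eta>) \<zeta> x2 y2"
    using edge_move_exists[OF \<Phi>\<eta>(2) _ _ _ e(4)] by blast
  then have \<zeta>': "edge_move (m / 2) (\<Phi> \<nu>') \<zeta> x1 y1"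
    using \<Phi>\<eta>(1) em'(2) by (auto simp: edge_move_def)
  have \<Phi>\<nu>': "\<Phi> \<nu>' \<in> W" using W_isometry_in_W[OF \<Phi>] W by blast
  obtain a b where ab: "edge_move m (?\<Psi> (\<Phi> \<eta>)) (?\<Psi> \<zeta>) a b"
    using W_isometry_edge_move[OF inv(1) \<Phi>\<eta>(2) \<zeta>] .
  obtain c d where cd: "edge_move (m / 2) (?\<Psi> (\<Phi> \<nu>')) (?\<Psi> \<zeta>) c d"
    using W_isometry_edge_move[OF inv(1) \<Phi>\<nu>' \<zeta>(1) \<zeta>'] .
  have "parallel x v x2 y2" by (rule W_isometry_parallel[OF \<Phi> fix_dirac W(1,3) em(2) em'(2)])
  moreover have "parallel x2 y2 a b"
    by (rule W_isometry_parallel[OF inv(1) fix_inv \<Phi>\<eta>(2) \<zeta> ab])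
  ultimately have "parallel x v a b" by (rule parallel_trans)
  then have "b \<noteq> x"
    using parallel_head_neq_tail e ab by (auto simp: edge_move_def)
  have "parallel x y x1 y1" by (rule W_isometry_parallel[OF \<Phi> fix_dirac W(1,2) em(1) em'(1)])
  moreover have "parallel x1 y1 c d"
    by (rule W_isometry_parallel[OF inv(1) fix_inv \<Phi>\<nu>' \<zeta>(1) \<zeta>' cd])
  ultimately have "parallel x y c d" by (rule parallel_trans)
  then have "d \<noteq> x"
    using parallel_head_neq_tail e cd by (auto simp: edge_move_def)
  have "pmf \<nu>' x = 0" using em(2) neq m by (simp add: edge_move_def)
  then have "pmf (?\<Psi> \<zeta>) x \<le> 0"
    using cd \<open>d \<noteq> x\<close> e(4) inv(3)[OF W(3)] by (simp add: edge_move_def)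
  moreover have "pmf \<eta> x = m / 2" using \<eta>(2) neq m by (simp add: edge_move_def)
  then have "pmf (?\<Psi> \<zeta>) x = m / 2 - (if x = a then m else 0)"
    using ab \<open>b \<noteq> x\<close> inv(3)[OF \<eta>(1)] by (simp add: edge_move_def)
  moreover have "0 \<le> pmf (?\<Psi> \<zeta>) x" by simp
  ultimately show False using e(4) by (auto split: if_splits)
qed

text \<open>
  It suffices that \<open>\<Phi>\<close> does not decrease the mass of any point \<open>x\<close>. A full move from \<open>x\<close> to a
  neighbour is mapped to an edge move of the same mass, which its source must have; so the point is
  that this source is \<open>x\<close> itself.
\<close>
lemma W_isometry_fixing_diracs:
  assumes \<Phi>: "W_isometry \<Phi>" and fix_dirac: "\<And>z. z \<in> X \<Longrightarrow> \<Phi> (return_pmf z) = return_pmf z"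
    and \<mu>: "\<mu> \<in> W"
  shows "\<Phi> \<mu> = \<mu>"
proof -
  have \<Phi>\<mu>: "\<Phi> \<mu> \<in> W" using W_isometry_in_W[OF \<Phi> \<mu>] .
  have le: "pmf \<mu> x \<le> pmf (\<Phi> \<mu>) x" for x
  proof (cases "pmf \<mu> x = 0")
    case False
    define m where "m = pmf \<mu> x"
    have m: "0 < m" using False by (simp add: m_def pmf_positive_iff[symmetric] set_pmf_iff)
    have x: "x \<in> X" using W_subset[OF \<mu>] False by (auto simp: set_pmf_iff)
    have move: "\<exists>\<nu>\<in>W. edge_move m \<mu> \<nu> x y" if "y \<in> X" "\<rho> x y = 1" for y
      using edge_move_exists[OF \<mu> x that m] by (auto simp: m_def)
    show ?thesis
    proof (cases "X = {x}")
      case True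
      then have "\<Phi> \<mu> = return_pmf x"
        using W_subset[OF \<Phi>\<mu>] by (simp add: set_pmf_subset_singleton)
      then show ?thesis by (simp add: pmf_le_1)
    next
      case False
      obtain y where "y \<in> X" "\<rho> x y = 1" using neighbour_exists[OF x False] .
      then obtain \<nu> where \<nu>: "\<nu> \<in> W" "edge_move m \<mu> \<nu> x y" using move by blast
      obtain x' y' where em': "edge_move m (\<Phi> \<mu>) (\<Phi> \<nu>) x' y'"
        using W_isometry_edge_move[OF \<Phi> \<mu> \<nu>] .
      then have x': "x' \<in> X" by (simp add: edge_move_def)
      have "x' = x"
      proof (rule ccontr)
        assume "x' \<noteq> x"
        \<comment> \<open>The first step of a geodesic from \<open>x\<close> to \<open>x'\<close>: it comes closer to \<open>x'\<close>, while an edge that starts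
          at \<open>x'\<close> leads away from it.\<close>
        then obtain v where v: "v \<in> X" "\<rho> x v = 1" "\<rho> v x' = \<rho> x x' - 1"
          using towards[OF x x'] by blast
        then obtain \<nu>' where \<nu>': "\<nu>' \<in> W" "edge_move m \<mu> \<nu>' x v" using move by blast
        obtain x'' v' where em'': "edge_move m (\<Phi> \<mu>) (\<Phi> \<nu>') x'' v'"
          using W_isometry_edge_move[OF \<Phi> \<mu> \<nu>'] .
        have "x' = x''"
          by (rule common_source[OF \<Phi> fix_dirac \<mu> \<nu>(1) \<nu>'(1) m_def \<nu>(2) \<nu>'(2) em' em''])
        then have "parallel x v x' v'"
          using W_isometry_parallel[OF \<Phi> fix_dirac \<mu> \<nu>' em''] by simp
        then have "\<rho> x' v powr p - \<rho> x' x powr p = \<rho> x' v' powr p - \<rho> x' x' powr p"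
          using x' by (simp add: parallel_def)
        moreover have "\<rho> x' v' = 1" using em'' \<open>x' = x''\<close> by (simp add: edge_move_def)
        moreover have "\<rho> x' v powr p \<le> \<rho> x' x powr p"
          using v(3) p_ge_1 nonneg[of v x'] by (intro powr_mono2) (auto simp: commute[of x'])
        ultimately show False using x' by simp
      qed
      then show ?thesis using edge_move_le[OF em'] by (simp add: m_def)
    qed
  qed simp
  show ?thesis
  proof (rule ccontr)
    assume "\<Phi> \<mu> \<noteq> \<mu>"
    then obtain x where "pmf (\<Phi> \<mu>) x < pmf \<mu> x" using pmf_neq_exists_less by blast
    with le[of x] show False by simp
  qed
qed

end

section \<open>Rigidity\<close>

context graph_wasserstein
begin

definition X_isometry :: "('a \<Rightarrow> 'a) \<Rightarrow> bool" where
  "X_isometry \<psi> \<longleftrightarrow> bij_betw \<psi> X X \<and> (\<forall>x\<in>X. \<forall>y\<in>X. \<rho> (\<psi> x) (\<psi> y) = \<rho> x y)"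

lemma X_isometry_inv: "X_isometry (inv_into X \<psi>)" if \<psi>: "X_isometry \<psi>"
proof -
  have bij: "bij_betw \<psi> X X" using \<psi> by (simp add: X_isometry_def)
  have "bij_betw (inv_into X \<psi>) X X" by (rule bij_betw_inv_into[OF bij])
  moreover from this have in_X: "inv_into X \<psi> x \<in> X" if "x \<in> X" for x
    using that by (auto simp: bij_betw_def)
  moreover have "\<rho> (inv_into X \<psi> x) (inv_into X \<psi> y) = \<rho> x y" if "x \<in> X" "y \<in> X" for x y
  proof -
    have "\<rho> (\<psi> (inv_into X \<psi> x)) (\<psi> (inv_into X \<psi> y)) = \<rho> (inv_into X \<psi> x) (inv_into X \<psi> y)"
      using \<psi> in_X[OF that(1)] in_X[OF that(2)] by (simp only: X_isometry_def)
    then show ?thesis using bij_betw_inv_into_right[OF bij] that by simp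
  qed
  ultimately show ?thesis by (simp add: X_isometry_def)
qed

lemma map_pmf_in_W:
  assumes "X_isometry \<psi>" "\<mu> \<in> W"
  shows "map_pmf \<psi> \<mu> \<in> W"
proof -
  obtain x0 where x0: "x0 \<in> X" "integrable (measure_pmf \<mu>) (\<lambda>x. \<rho> x x0 powr p)"
    using assms(2) by (auto simp: W_iff)
  have X: "\<psi> x \<in> X" if "x \<in> X" for x
    using that assms(1) by (auto simp: X_isometry_def bij_betw_def)
  have "integrable (measure_pmf \<mu>) (\<lambda>x. \<rho> (\<psi> x) (\<psi> x0) powr p)
      \<longleftrightarrow> integrable (measure_pmf \<mu>) (\<lambda>x. \<rho> x x0 powr p)"
    using assms(1) x0 W_subset[OF assms(2)]
    by (intro integrable_cong_AE AE_pmfI) (auto simp: X_isometry_def)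
  then have "integrable (measure_pmf (map_pmf \<psi> \<mu>)) (\<lambda>x. \<rho> x (\<psi> x0) powr p)"
    using x0 by simp
  then show ?thesis using X x0 W_subset[OF assms(2)] by (auto simp: W_iff)
qed

lemma opt_cost_map_pmf_le:
  assumes "X_isometry \<psi>" "\<mu> \<in> W" "\<nu> \<in> W"
  shows "opt_cost (map_pmf \<psi> \<mu>) (map_pmf \<psi> \<nu>) \<le> opt_cost \<mu> \<nu>"
proof -
  obtain \<pi> where \<pi>: "\<pi> \<in> couplings \<mu> \<nu>" "plan_cost \<pi> = opt_cost \<mu> \<nu>"
    using optimal_coupling[OF assms(2,3)] .
  let ?\<pi> = "map_pmf (map_prod \<psi> \<psi>) \<pi>"
  have "?\<pi> \<in> couplings (map_pmf \<psi> \<mu>) (map_pmf \<psi> \<nu>)"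
    using \<pi>(1) by (auto simp: couplings_def map_pmf_comp)
  then have "opt_cost (map_pmf \<psi> \<mu>) (map_pmf \<psi> \<nu>) \<le> plan_cost ?\<pi>" by (rule opt_cost_le)
  also have "\<dots> = measure_pmf.expectation \<pi> (\<lambda>w. cost (map_prod \<psi> \<psi> w))"
    by (simp add: plan_cost_def)
  also have "\<dots> = plan_cost \<pi>"
    unfolding plan_cost_def
    using assms(1) coupling_in_X[OF \<pi>(1) assms(2) W_subset[OF assms(3)]]
    by (intro integral_cong_AE AE_pmfI) (auto simp: cost_def X_isometry_def)
  finally show ?thesis using \<pi>(2) by simp
qed

lemma map_pmf_inv_into:
  assumes "bij_betw \<psi> X X" "\<mu> \<in> W"
  shows "map_pmf (inv_into X \<psi>) (map_pmf \<psi> \<mu>) = \<mu>" "map_pmf \<psi> (map_pmf (inv_into X \<psi>) \<mu>) = \<mu>"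
  using W_subset[OF assms(2)] bij_betw_inv_into_left[OF assms(1)] bij_betw_inv_into_right[OF assms(1)]
  by (auto simp: map_pmf_comp intro!: map_pmf_idI)

lemma W_isometry_map_pmf: "W_isometry (map_pmf \<psi>)" if \<psi>: "X_isometry \<psi>"
proof -
  let ?\<phi> = "inv_into X \<psi>"
  note inv = X_isometry_inv[OF \<psi>]
  have bij: "bij_betw \<psi> X X" using \<psi> by (simp add: X_isometry_def)
  have "bij_betw (map_pmf \<psi>) W W"
    by (rule bij_betw_byWitness[where f' = "map_pmf ?\<phi>"])
       (use map_pmf_inv_into[OF bij] map_pmf_in_W[OF \<psi>] map_pmf_in_W[OF inv] in auto)
  moreover have "opt_cost (map_pmf \<psi> \<mu>) (map_pmf \<psi> \<nu>) = opt_cost \<mu> \<nu>" if "\<mu> \<in> W" "\<nu> \<in> W" for \<mu> \<nu>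
    using opt_cost_map_pmf_le[OF \<psi> that]
      opt_cost_map_pmf_le[OF inv map_pmf_in_W[OF \<psi> that(1)] map_pmf_in_W[OF \<psi> that(2)]]
      map_pmf_inv_into(1)[OF bij] that by simp
  ultimately show ?thesis by (simp add: W_isometry_def)
qed

lemma W_isometry_is_map_pmf:
  assumes \<Phi>: "W_isometry \<Phi>"
  obtains \<psi> where "X_isometry \<psi>" "\<And>\<mu>. \<mu> \<in> W \<Longrightarrow> \<Phi> \<mu> = map_pmf \<psi> \<mu>"
proof -
  have "\<exists>x'. x' \<in> X \<and> \<Phi> (return_pmf x) = return_pmf x'" if "x \<in> X" for x
    using W_isometry_return_pmf[OF \<Phi> that] by blast
  then obtain \<psi> where \<psi>: "\<And>x. x \<in> X \<Longrightarrow> \<psi> x \<in> X \<and> \<Phi> (return_pmf x) = return_pmf (\<psi> x)"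
    by metis
  have powr_inverse: "(a powr p) powr (1 / p) = a" if "0 \<le> a" for a :: real
    using that p_ge_1 by (simp add: powr_powr)
  have root: "a = b" if "a powr p = b powr p" "0 \<le> a" "0 \<le> b" for a b :: real
    using powr_inverse that by metis
  have dist: "\<rho> (\<psi> x) (\<psi> y) = \<rho> x y" if "x \<in> X" "y \<in> X" for x y
  proof (rule root)
    show "\<rho> (\<psi> x) (\<psi> y) powr p = \<rho> x y powr p"
      using W_isometry_opt_cost[OF \<Phi> return_pmf_in_W[OF that(1)] return_pmf_in_W[OF that(2)]]
        \<psi>[OF that(1)] \<psi>[OF that(2)] by (simp add: opt_cost_return_return)
  qed simp_all
  have "inj_on \<psi> X"
  proof (rule inj_onI)
    fix x y assume "x \<in> X" "y \<in> X" "\<psi> x = \<psi> y"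
    then show "x = y" using dist[of x y] \<psi>[of y] by simp
  qed
  moreover have "\<psi> ` X = X"
  proof (intro equalityI subsetI)
    fix y assume y: "y \<in> X"
    obtain x where x: "x \<in> X" "inv_into W \<Phi> (return_pmf y) = return_pmf x"
      using W_isometry_return_pmf[OF W_isometry_inv(1)[OF \<Phi>] y] .
    then have "\<Phi> (return_pmf x) = return_pmf y"
      using W_isometry_inv(2)[OF \<Phi> return_pmf_in_W[OF y]] by simp
    then show "y \<in> \<psi> ` X" using \<psi>[OF x(1)] x(1) by auto
  qed (use \<psi> in auto)
  ultimately have bij: "bij_betw \<psi> X X" by (simp add: bij_betw_def)
  then have iso: "X_isometry \<psi>" using dist by (simp add: X_isometry_def)
  let ?\<Psi> = "map_pmf (inv_into X \<psi>) \<circ> \<Phi>"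
  have \<Psi>: "W_isometry ?\<Psi>"
    by (rule W_isometry_comp[OF \<Phi> W_isometry_map_pmf[OF X_isometry_inv[OF iso]]])
  have "\<Phi> \<mu> = map_pmf \<psi> \<mu>" if \<mu>: "\<mu> \<in> W" for \<mu>
  proof -
    have "?\<Psi> \<mu> = \<mu>"
      by (rule W_isometry_fixing_diracs[OF \<Psi> _ \<mu>]) (use \<psi> bij_betw_inv_into_left[OF bij] in auto)
    then have "map_pmf \<psi> (?\<Psi> \<mu>) = map_pmf \<psi> \<mu>" by simp
    then show ?thesis
      using map_pmf_inv_into(2)[OF bij W_isometry_in_W[OF \<Phi> \<mu>]] by simp
  qed
  with iso show ?thesis by (rule that)
qed

lemma W_isometry_iff:
  "W_isometry \<Phi> \<longleftrightarrow> bij_betw \<Phi> W W \<and>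
    (\<forall>\<mu>\<in>W. \<forall>\<nu>\<in>W. wasserstein_dist X \<rho> p (\<Phi> \<mu>) (\<Phi> \<nu>) = wasserstein_dist X \<rho> p \<mu> \<nu>)"
proof (cases "bij_betw \<Phi> W W")
  case True
  then have "\<Phi> \<mu> \<in> W" if "\<mu> \<in> W" for \<mu> using that by (auto simp: bij_betw_def)
  then have "opt_cost (\<Phi> \<mu>) (\<Phi> \<nu>) = opt_cost \<mu> \<nu> \<longleftrightarrow>
      wasserstein_dist X \<rho> p (\<Phi> \<mu>) (\<Phi> \<nu>) = wasserstein_dist X \<rho> p \<mu> \<nu>"
    if "\<mu> \<in> W" "\<nu> \<in> W" for \<mu> \<nu>
    using that opt_cost_eq[OF that] opt_cost_eq[of "\<Phi> \<mu>" "\<Phi> \<nu>"]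
      wasserstein_dist_eq[OF that] wasserstein_dist_eq[of "\<Phi> \<mu>" "\<Phi> \<nu>"]
    by fastforce
  with True show ?thesis by (simp add: W_isometry_def)
qed (simp add: W_isometry_def)

lemma carrier_Isom_X: "\<psi> \<in> carrier (Isom X \<rho>) \<longleftrightarrow> \<psi> \<in> extensional X \<and> X_isometry \<psi>"
  by (auto simp: Isom_def Bij_def X_isometry_def)

lemma carrier_Isom_W:
  "\<Phi> \<in> carrier (Isom W (wasserstein_dist X \<rho> p)) \<longleftrightarrow> \<Phi> \<in> extensional W \<and> W_isometry \<Phi>"
  by (auto simp: Isom_def Bij_def W_isometry_iff)

lemma mult_Isom:
  "f \<in> carrier (Isom Y d) \<Longrightarrow> g \<in> carrier (Isom Y d) \<Longrightarrow> f \<otimes>\<^bsub>Isom Y d\<^esub> g = compose Y f g"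
  by (simp add: Isom_def BijGroup_def)

lemma W_isometry_cong: "(\<And>\<mu>. \<mu> \<in> W \<Longrightarrow> \<Phi> \<mu> = \<Psi> \<mu>) \<Longrightarrow> W_isometry \<Phi> = W_isometry \<Psi>"
  by (simp add: W_isometry_def cong: bij_betw_cong)

lemma X_isometry_restrict: "X_isometry (restrict \<psi> X) = X_isometry \<psi>"
  by (simp add: X_isometry_def cong: bij_betw_cong)

lemma push_forward_iso: "push_forward X \<rho> p \<in> iso (Isom X \<rho>) (Isom W (wasserstein_dist X \<rho> p))"
  (is "?push \<in> iso ?GX ?GW")
proof (rule isoI)
  have carrier: "?push \<psi> \<in> carrier ?GW" if "\<psi> \<in> carrier ?GX" for \<psi>
  proof -
    have "W_isometry (map_pmf \<psi>)" using W_isometry_map_pmf that by (simp add: carrier_Isom_X)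
    then have "W_isometry (?push \<psi>)"
      by (rule W_isometry_cong[THEN iffD1, rotated]) (simp add: push_forward_def)
    then show ?thesis by (simp add: carrier_Isom_W push_forward_def)
  qed
  show "?push \<in> hom ?GX ?GW"
  proof (rule homI)
    fix \<psi> \<phi> assume \<psi>: "\<psi> \<in> carrier ?GX" and \<phi>: "\<phi> \<in> carrier ?GX"
    have "?push (compose X \<psi> \<phi>) \<mu> = compose W (?push \<psi>) (?push \<phi>) \<mu>" for \<mu>
    proof (cases "\<mu> \<in> W")
      case True
      then have "map_pmf \<phi> \<mu> \<in> W"
        using map_pmf_in_W \<phi> by (simp add: carrier_Isom_X)
      moreover have "map_pmf (compose X \<psi> \<phi>) \<mu> = map_pmf \<psi> (map_pmf \<phi> \<mu>)"
        using W_subset[OF True] by (auto simp: map_pmf_comp compose_def intro!: map_pmf_cong)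
      ultimately show ?thesis using True by (simp add: push_forward_def compose_def)
    qed (simp add: push_forward_def compose_def)
    then show "?push (\<psi> \<otimes>\<^bsub>?GX\<^esub> \<phi>) = ?push \<psi> \<otimes>\<^bsub>?GW\<^esub> ?push \<phi>"
      using \<psi> \<phi> carrier by (simp add: mult_Isom fun_eq_iff)
  qed (rule carrier)
  show "bij_betw ?push (carrier ?GX) (carrier ?GW)"
  proof (rule bij_betw_imageI)
    show "inj_on ?push (carrier ?GX)"
    proof (rule inj_onI)
      fix \<psi> \<phi> assume \<psi>: "\<psi> \<in> carrier ?GX" and \<phi>: "\<phi> \<in> carrier ?GX" and eq: "?push \<psi> = ?push \<phi>"
      have "\<psi> x = \<phi> x" if "x \<in> X" for x
        using fun_cong[OF eq, of "return_pmf x"] return_pmf_in_W[OF that]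
        by (simp add: push_forward_def)
      then show "\<psi> = \<phi>"
        using \<psi> \<phi> by (intro extensionalityI[of \<psi> X \<phi>]) (auto simp: carrier_Isom_X)
    qed
    show "?push ` carrier ?GX = carrier ?GW"
    proof (intro equalityI subsetI)
      fix \<Phi> assume \<Phi>: "\<Phi> \<in> carrier ?GW"
      then have "W_isometry \<Phi>" by (simp add: carrier_Isom_W)
      then obtain \<psi> where \<psi>: "X_isometry \<psi>" and eq: "\<And>\<mu>. \<mu> \<in> W \<Longrightarrow> \<Phi> \<mu> = map_pmf \<psi> \<mu>"
        using W_isometry_is_map_pmf by blast
      have "map_pmf (restrict \<psi> X) \<mu> = map_pmf \<psi> \<mu>" if "\<mu> \<in> W" for \<mu>
        using W_subset[OF that] by (intro map_pmf_cong) auto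
      then have "?push (restrict \<psi> X) = \<Phi>"
        using \<Phi> eq by (intro extensionalityI[of _ W]) (auto simp: push_forward_def carrier_Isom_W)
      moreover have "restrict \<psi> X \<in> carrier ?GX"
        using \<psi> by (simp add: carrier_Isom_X X_isometry_restrict)
      ultimately show "\<Phi> \<in> ?push ` carrier ?GX" by blast
    qed (use carrier in auto)
  qed
qed

end

theorem theorem6:
  fixes X :: "'a set" and \<rho> :: "'a \<Rightarrow> 'a \<Rightarrow> real" and p :: real
  assumes "countable X"
    and "graph_metric_space X \<rho>"
    and "p \<ge> 1"
  defines "W \<equiv> wasserstein_space X \<rho> p"
    and "d \<equiv> wasserstein_dist X \<rho> p"
  shows "(\<forall>\<Phi>. bij_betw \<Phi> W W \<and> (\<forall>\<mu>\<in>W. \<forall>\<nu>\<in>W. d (\<Phi> \<mu>) (\<Phi> \<nu>) = d \<mu> \<nu>) \<longrightarrow>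
            (\<exists>\<psi>. bij_betw \<psi> X X \<and> (\<forall>x\<in>X. \<forall>y\<in>X. \<rho> (\<psi> x) (\<psi> y) = \<rho> x y) \<and>
                 (\<forall>\<mu>\<in>W. \<Phi> \<mu> = push_forward X \<rho> p \<psi> \<mu>)))
       \<and> push_forward X \<rho> p \<in> epi (Isom X \<rho>) (Isom W d)
       \<and> Isom W d \<cong> Isom X \<rho>"
proof (intro conjI allI impI)
  interpret graph_wasserstein X \<rho> p
  proof (unfold graph_wasserstein_def graph_wasserstein_axioms_def, intro conjI allI impI)
    show "Metric_space X \<rho>" using assms(2) by (simp add: graph_metric_space_def)
  qed (use assms(3) graph_metric_space_towards[OF assms(2)] in auto)
  have iso: "push_forward X \<rho> p \<in> iso (Isom X \<rho>) (Isom W d)"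
    unfolding W_def d_def by (rule push_forward_iso)
  then show "push_forward X \<rho> p \<in> epi (Isom X \<rho>) (Isom W d)"
    by (simp add: iso_iff_mon_epi)
  have "Isom X \<rho> \<cong> Isom W d" using iso by (rule is_isoI)
  then show "Isom W d \<cong> Isom X \<rho>" by (rule group.iso_sym[OF group_Isom])
  fix \<Phi>
  assume "bij_betw \<Phi> W W \<and> (\<forall>\<mu>\<in>W. \<forall>\<nu>\<in>W. d (\<Phi> \<mu>) (\<Phi> \<nu>) = d \<mu> \<nu>)"
  then have "W_isometry \<Phi>" by (simp add: W_isometry_iff W_def d_def)
  then obtain \<psi> where "X_isometry \<psi>" "\<And>\<mu>. \<mu> \<in> W \<Longrightarrow> \<Phi> \<mu> = map_pmf \<psi> \<mu>"
    unfolding W_def using W_isometry_is_map_pmf by blast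
  then show "\<exists>\<psi>. bij_betw \<psi> X X \<and> (\<forall>x\<in>X. \<forall>y\<in>X. \<rho> (\<psi> x) (\<psi> y) = \<rho> x y) \<and>
      (\<forall>\<mu>\<in>W. \<Phi> \<mu> = push_forward X \<rho> p \<psi> \<mu>)"
    by (intro exI[of _ \<psi>]) (auto simp: X_isometry_def push_forward_def W_def)
qed

end
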